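(* Let $\alpha\in\mathbb{Z}/p\mathbb{Z}$; all entries and congruences below are in $\mathbb{Z}/p\mathbb{Z}$. (1) A $p$-regular partition $\lambda$ whose residue symbol has length $1$, $R_p(\lambda)=\left\{\begin{smallmatrix} x_1\\ y_1\end{smallmatrix}\right\}$, is a JS-partition of type $\alpha$ if and only if $(x_1,y_1)$ is one of $(0,\alpha)$ (only possible when $\alpha\neq 1$), $(\alpha,0)$, or $(\alpha,\alpha+1)$ (only possible when $\alpha\ne 0$). (2) Let $\mu$ be a $p$-regular partition with residue symbol $R_p(\mu)=\left\{\begin{smallmatrix} x_1&\cdots&x_k&x_{k+1}\\ y_1&\cdots&y_k&y_{k+1}\end{smallmatrix}\right\}$ of length $k+1\ge 2$, and let $\lambda$ be the partition with residue symbol $\left\{\begin{smallmatrix} x_1&\cdots&x_k\\ y_1&\cdots&y_k\end{smallmatrix}\right\}$ (i.e. $\mu$ with its $p$-rim removed). Then $\mu$ is a JS-partition of type $\alpha$ if and only if $\lambda$ is a JS-partition of type $\alpha$ and $(x_{k+1},y_{k+1})$ is one of the following: - $(\alpha+1-y_k,\ y_k-1)$, allowed only if $2y_k\not\equiv \alpha+3$ (regular extension); - $(y_k-1,\ \alpha+1-y_k)$, allowed only if $2y_k\not\equiv\alpha+1$ (regular extension); - $(y_k-1,\ y_k)$ (singular extension); - $(\alpha+1-y_k,\ \alpha+2-y_k)$ (singular extension). (3) If $\lambda$ is a JS-partition of type $\alpha$ with residue symbol of length $k$ and last column $\left\{\begin{smallmatrix} x_k\\ y_k\end{smallmatrix}\right\}$,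 and $\sigma=(\sigma_0,\dots,\sigma_{p-1})$ is its end value vector, then one of the following holds (with $e_i$ the vector of length $p$ having $1$ at position $i$ and $0$ elsewhere, and residues represented in $\{0,\dots,p-1\}$): (a) $\sigma=-e_0$ and $y_k\in\{1,\alpha+1\}$; (b) $\sigma=e_\alpha-e_\beta-e_{\alpha-\beta}$ for some residue $\beta\neq\alpha$, and $y_k\in\{1+\beta,\ \alpha+1-\beta\}$; (c) either $\alpha\neq 0$ is even, $\sigma=e_\alpha-2e_{\alpha/2}$ and $y_k=\frac{\alpha}{2}+1$; or $\alpha+p$ is even, $\sigma=e_\alpha-2e_{(p+\alpha)/2}$ and $y_k=\frac{\alpha+p}{2}+1$.
   Context: Fix an integer $p\ge 2$. A partition is written $\lambda=(l_1^{a_1},\dots,l_t^{a_t})$ with $l_1>\dots>l_t>0$ and $a_i\ge1$ (the first $a_1$ parts equal $l_1$, the next $a_2$ equal $l_2$, etc.); it is $p$-regular if $a_i\le p-1$ for all $i$. Its Young diagram is $Y(\lambda)=\{(i,j): 1\le i\le k, 1\le j\le\lambda_i\}$ where $\lambda_1\ge\dots\ge\lambda_k>0$ are the parts. A $p$-regular $\lambda$ is a JS-partition if $l_i-l_{i+1}+a_i+a_{i+1}\equiv 0\pmod p$ for $1\le i<t$; its type is the residue of $l_1-a_1$ mod $p$. Mullineux and residue symbols: the rim of $\lambda$ is the set of nodes $(i,j)\in Y(\lambda)$ with $(i+1,j+1)\notin Y(\lambda)$, ordered from the last node of the first row to the first node of the last row. The $p$-rim is the union of $p$-segments: the first $p$-segment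 consists of the first $p$ nodes of the rim (all of it if it has at most $p$ nodes); each next $p$-segment consists of the first $p$ nodes (or all remaining nodes) of the rim starting at the last node of the row immediately below the lowest row of the previous segment; this continues until the last row is reached. Let $a_1$ be the number of nodes of the $p$-rim of $\lambda^{(1)}=\lambda$ and $r_1$ its number of parts; removing the $p$-rim gives a $p$-regular partition $\lambda^{(2)}$; iterate to get $\lambda^{(1)},\dots,\lambda^{(m)}\ne\emptyset$, $\lambda^{(m+1)}=\emptyset$, with $a_j$ = size of the $p$-rim of $\lambda^{(j)}$ and $r_j$ = number of parts of $\lambda^{(j)}$. The Mullineux symbol is $G_p(\lambda)=\begin{pmatrix}a_1&\cdots&a_m\\ r_1&\cdots&r_m\end{pmatrix}$. The residue symbol is $R_p(\lambda)=\left\{\begin{smallmatrix}x_1&\cdots&x_m\\ y_1&\cdots&y_m\end{smallmatrix}\right\}$ with $x_j\equiv a_{m+1-j}-r_{m+1-j}$ and $y_j\equiv 1-r_{m+1-j}\pmod p$; $m$ is its length. Thus removing the last column of $R_p(\lambda)$ gives $R_p(\lambda^{(2)})$. A column is singular if $y_j=x_j+1$ (equivalently $p\mid a_{m+1-j}$) and regular otherwise. Mullineux sequence and end values: $M(\lambda)$ is the sequence of signed residues $0-,\ x_1+,\ (x_1+1)-,\ y_1+,\ (y_1-1)-,\ x_2+,\ (x_2+1)-,\ y_2+,\ (y_2-1)-,\ \dots,\ x_m+,\ (x_m+1)-,\ y_m+,\ (y_m-1)-$. For a residue $\beta$, the end value $\sigma_\beta$ is the sum, over all entries of $M(\lambda)$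 with residue $\beta$, of their signs ($+$ counts $+1$, $-$ counts $-1$). The end value vector is $\sigma=(\sigma_0,\dots,\sigma_{p-1})$. *)

theory Defs
  imports "HOL-Number_Theory.Cong"
begin

definition is_partition :: "nat list \<Rightarrow> bool" where
  "is_partition l \<longleftrightarrow> sorted_wrt (\<ge>) l \<and> (\<forall>x\<in>set l. 0 < x)"

definition p_regular :: "nat \<Rightarrow> nat list \<Rightarrow> bool" where
  "p_regular p l \<longleftrightarrow> is_partition l \<and> (\<forall>x\<in>set l. count_list l x \<le> p - 1)"

text \<open>The pairs \<open>(l\<^sub>1, a\<^sub>1), \<dots>, (l\<^sub>t, a\<^sub>t)\<close> of the exponential notation
  \<open>(l\<^sub>1\<^bsup>a\<^sub>1\<^esup>, \<dots>, l\<^sub>t\<^bsup>a\<^sub>t\<^esup>)\<close>; on a weakly decreasing list, \<open>remdups\<close> lists the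
  distinct parts in decreasing order.\<close>

definition exponential_form :: "nat list \<Rightarrow> (nat \<times> nat) list" where
  "exponential_form l = map (\<lambda>x. (x, count_list l x)) (remdups l)"

definition JS_partition :: "nat \<Rightarrow> nat list \<Rightarrow> bool" where
  "JS_partition p l \<longleftrightarrow> p_regular p l \<and>
     (let E = exponential_form l in
      \<forall>i. Suc i < length E \<longrightarrow>
        [int (fst (E ! i)) - int (fst (E ! Suc i)) + int (snd (E ! i)) + int (snd (E ! Suc i)) = 0]
          (mod int p))"

text \<open>The type is only meaningful for a nonempty partition.\<close>

definition JS_partition_of_type :: "nat \<Rightarrow> int \<Rightarrow> nat list \<Rightarrow> bool" where
  "JS_partition_of_type p \<alpha> l \<longleftrightarrow> JS_partition p l \<and> l \<noteq> [] \<and>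
     (let (l1, a1) = hd (exponential_form l) in [int l1 - int a1 = \<alpha>] (mod int p))"

text \<open>Nodes are 1-based pairs (row, column).\<close>

definition young_diagram :: "nat list \<Rightarrow> (nat \<times> nat) set" where
  "young_diagram l = {(i, j). 1 \<le> i \<and> i \<le> length l \<and> 1 \<le> j \<and> j \<le> l ! (i - 1)}"

text \<open>The rim as a list, from the last node of the first row to the first node of the last row:
  rows downwards, each row from right to left.\<close>

definition rim :: "nat list \<Rightarrow> (nat \<times> nat) list" where
  "rim l = [(i, j). i \<leftarrow> [1..<length l + 1], j \<leftarrow> rev [1..<l ! (i - 1) + 1],
              (i + 1, j + 1) \<notin> young_diagram l]"

text \<open>Splitting a stretch of the rim into \<open>p\<close>-segments. The first segment is \<open>take p\<close> of it, and the
  lowest row of a segment is the row of its last node. The next segment starts at the last node of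
  the next row, which is the first rim node strictly below that row.\<close>

fun p_segments :: "nat \<Rightarrow> (nat \<times> nat) list \<Rightarrow> (nat \<times> nat) list list" where
  "p_segments p [] = []"
| "p_segments p (v # vs) =
     (let seg = take p (v # vs)
      in seg # p_segments p (filter (\<lambda>w. fst (last seg) < fst w) vs))"

definition p_rim :: "nat \<Rightarrow> nat list \<Rightarrow> (nat \<times> nat) set" where
  "p_rim p l = \<Union> (set ` set (p_segments p (rim l)))"

definition remove_p_rim :: "nat \<Rightarrow> nat list \<Rightarrow> nat list" where
  "remove_p_rim p l =
     filter (\<lambda>n. 0 < n)
       (map (\<lambda>i. card {j. (i, j) \<in> young_diagram l - p_rim p l}) [1..<length l + 1])"

lemma finite_young_diagram_row: "finite {j. (i, j) \<in> young_diagram l}"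
  by (rule finite_subset[of _ "{..l ! (i - 1)}"]) (auto simp: young_diagram_def)

lemma card_young_diagram_row:
  assumes "1 \<le> i" "i \<le> length l"
  shows "card {j. (i, j) \<in> young_diagram l} = l ! (i - 1)"
proof -
  have "{j. (i, j) \<in> young_diagram l} = {1..l ! (i - 1)}"
    using assms by (auto simp: young_diagram_def)
  then show ?thesis by simp
qed

lemma p_rim_nonempty:
  assumes "0 < p" "(i, j) \<in> young_diagram l"
  shows "p_rim p l \<inter> young_diagram l \<noteq> {}"
proof -
  have fin: "finite (young_diagram l)"
    by (rule finite_subset[of _ "Sigma {..length l} (\<lambda>i. {..l ! (i - 1)})"])
       (auto simp: young_diagram_def)
  have rim_set: "set (rim l) = {(i, j). (i, j) \<in> young_diagram l \<and> (i + 1, j + 1) \<notin> young_diagram l}"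
    by (auto simp: rim_def young_diagram_def)
  define i' where "i' = Max (fst ` young_diagram l)"
  have "i' \<in> fst ` young_diagram l"
    unfolding i'_def using fin assms by (intro Max_in) auto
  then obtain j' where j': "(i', j') \<in> young_diagram l" by force
  have "(i' + 1, j' + 1) \<notin> young_diagram l"
  proof
    assume "(i' + 1, j' + 1) \<in> young_diagram l"
    then have "i' + 1 \<in> fst ` young_diagram l" by force
    then have "i' + 1 \<le> i'" unfolding i'_def using fin by (intro Max_ge) auto
    then show False by simp
  qed
  with j' have "rim l \<noteq> []" using rim_set by force
  then obtain v vs where v: "rim l = v # vs" by (cases "rim l") auto
  then have "v \<in> set (rim l)" by simp
  then have "v \<in> young_diagram l" unfolding rim_set by auto
  moreover have "v \<in> p_rim p l"
    using v assms(1) by (cases p) (auto simp: p_rim_def Let_def)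
  ultimately show ?thesis by blast
qed

lemma sum_list_filter_pos: "sum_list (filter (\<lambda>n. 0 < n) xs) = sum_list (xs :: nat list)"
  by (induction xs) auto

lemma remove_p_rim_decreases:
  assumes "0 < p" "l \<noteq> []"
  shows "sum_list (remove_p_rim p l) + length (remove_p_rim p l) < sum_list l + length l"
proof -
  define f where "f i = card {j. (i, j) \<in> young_diagram l - p_rim p l}" for i
  have len: "length (remove_p_rim p l) \<le> length l"
    unfolding remove_p_rim_def by (rule order.trans[OF length_filter_le]) (simp del: upt_Suc)
  have s1: "sum_list (remove_p_rim p l) = (\<Sum>i=1..length l. f i)"
    unfolding remove_p_rim_def sum_list_filter_pos f_def
    by (simp add: sum_list_distinct_conv_sum_set atLeastLessThanSuc_atLeastAtMost del: upt_Suc)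
  have s2: "sum_list l = (\<Sum>i=1..length l. l ! (i - 1))"
    unfolding sum_list_sum_nth
    by (rule sum.reindex_bij_witness[of _ "\<lambda>i. i - 1" Suc]) auto
  have le: "f i \<le> l ! (i - 1)" if "i \<in> {1..length l}" for i
    using that card_young_diagram_row[of i l]
      card_mono[OF finite_young_diagram_row, of "{j. (i, j) \<in> young_diagram l - p_rim p l}" i l]
    by (auto simp: f_def)
  show ?thesis
  proof (cases "young_diagram l = {}")
    case True
    then have "f i = 0" for i by (simp add: f_def)
    then have "remove_p_rim p l = []"
      by (auto simp: remove_p_rim_def f_def filter_empty_conv)
    then show ?thesis using assms by simp
  next
    case False
    then obtain i0 j0 where "(i0, j0) \<in> young_diagram l" by force
    then obtain i j where ij: "(i, j) \<in> p_rim p l" "(i, j) \<in> young_diagram l"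
      using p_rim_nonempty[OF assms(1)] by fastforce
    then have i: "1 \<le> i" "i \<le> length l" by (auto simp: young_diagram_def)
    have "f i < card {j. (i, j) \<in> young_diagram l}"
      unfolding f_def using ij by (intro psubset_card_mono finite_young_diagram_row) auto
    then have "f i < l ! (i - 1)" using card_young_diagram_row[OF i] by simp
    then have "sum_list (remove_p_rim p l) < sum_list l"
      unfolding s1 s2 using le i by (intro sum_strict_mono_ex1) auto
    then show ?thesis using len by simp
  qed
qed

text \<open>The columns \<open>(a\<^sub>1, r\<^sub>1), \<dots>, (a\<^sub>m, r\<^sub>m)\<close>. The guard \<open>p = 0\<close> only serves termination.\<close>

function mullineux_symbol :: "nat \<Rightarrow> nat list \<Rightarrow> (nat \<times> nat) list" where
  "mullineux_symbol p l =
     (if p = 0 \<or> l = [] then []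
      else (card (p_rim p l), length l) # mullineux_symbol p (remove_p_rim p l))"
  by auto
termination
  by (relation "measure (\<lambda>(p, l). sum_list l + length l)") (auto intro: remove_p_rim_decreases)

declare mullineux_symbol.simps [simp del]

text \<open>Residues modulo \<open>p\<close> are represented by integers in \<open>{0..<p}\<close>. The columns of the residue symbol
  are in the reverse order of those of the Mullineux symbol.\<close>

definition residue_symbol :: "nat \<Rightarrow> nat list \<Rightarrow> (int \<times> int) list" where
  "residue_symbol p l =
     map (\<lambda>(a, r). ((int a - int r) mod int p, (1 - int r) mod int p)) (rev (mullineux_symbol p l))"

lemma residue_symbol_remove_p_rim:
  "residue_symbol p (remove_p_rim p l) = butlast (residue_symbol p l)" if "0 < p" "l \<noteq> []"
  using that by (simp add: residue_symbol_def mullineux_symbol.simps[of p l])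

text \<open>The entries are (residue, sign) with sign \<open>1\<close> or \<open>-1\<close>; residues are taken modulo \<open>p\<close>.\<close>

definition mullineux_sequence :: "nat \<Rightarrow> nat list \<Rightarrow> (int \<times> int) list" where
  "mullineux_sequence p l =
     (0, -1) # concat (map (\<lambda>(x, y). [(x, 1), (x + 1, -1), (y, 1), (y - 1, -1)]) (residue_symbol p l))"

definition end_value :: "nat \<Rightarrow> nat list \<Rightarrow> int \<Rightarrow> int" where
  "end_value p l \<beta> =
     sum_list (map snd (filter (\<lambda>(\<gamma>, s). [\<gamma> = \<beta>] (mod int p)) (mullineux_sequence p l)))"

text \<open>Vectors of length \<open>p\<close> are functions on the residues \<open>{0..<p}\<close>; this is the entry of \<open>e\<^sub>i\<close>
  at position \<open>\<gamma>\<close>, where the index \<open>i\<close> may be any representative of a residue.\<close>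

definition unit_vec :: "nat \<Rightarrow> int \<Rightarrow> int \<Rightarrow> int" where
  "unit_vec p i \<gamma> = (if [\<gamma> = i] (mod int p) then 1 else 0)"

end

theory Submission
  imports Defs
begin

text \<open>
  For a block \<open>x\<^sup>a\<close> of a partition call \<open>x - a\<close> its entry and \<open>x + a\<close> its exit. A
  \<open>p\<close>-regular partition is a JS-partition of type \<open>\<alpha>\<close> iff its first entry is \<open>\<alpha>\<close> and every exit is
  the next entry modulo \<open>p\<close>; the last exit is then \<open>\<omega> = \<alpha> + 2r\<close>, where \<open>r\<close> is the number of parts.

  In a JS-partition every complete \<open>p\<close>-segment lies in one block or consists of exactly two
  consecutive blocks \<open>x\<^sup>a, x'\<^bsup>a'\<^esup>\<close> with \<open>x - x' + a + a' = p\<close>. Removing the \<open>p\<close>-rim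
  therefore turns a single block into \<open>(x-1)\<^bsup>a-1\<^esup>, (x+a-p-1)\<close> and a pair into
  \<open>(x-1)\<^bsup>a-1\<^esup>, (x'-1)\<^bsup>a'+1\<^esup>\<close>, which preserves entries and exits, so only the bottom of the
  diagram matters. With \<open>s\<close> the number of parts that disappear and \<open>k\<close> the size of the \<open>p\<close>-rim, the
  possibilities there are \<open>k = 0\<close> with \<open>s \<in> {0, -\<omega>}\<close>, or \<open>s = 1\<close> with \<open>k = \<omega> + 1\<close>, or
  \<open>k = s = 1 - \<omega>\<close>, modulo \<open>p\<close>; these are the four columns. Conversely the \<open>p\<close>-rim can be put back
  row by row from the bottom, again one block or one pair of blocks at a time.

  Along the four extensions the end value vector keeps the form
  \<open>e\<^sub>\<alpha> - e\<^bsub>-r\<^esub> - e\<^bsub>\<alpha>+r\<^esub>\<close>, where \<open>y\<^sub>k = 1 - r\<close>.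
\<close>

section \<open>Row by row removal of the \<open>p\<close>-rim\<close>

text \<open>The parts left over, zeros included, when the current segment may still take \<open>b\<close> nodes; row \<open>x\<close>
  has \<open>n\<close> rim nodes.\<close>

fun strip :: "nat \<Rightarrow> nat \<Rightarrow> nat list \<Rightarrow> nat list" where
  "strip p b [] = []"
| "strip p b (x # xs) =
     (let n = Suc x - (if xs = [] then 1 else hd xs)
      in if b \<le> n then (x - b) # strip p p xs else (x - n) # strip p (b - n) xs)"

fun rim_from :: "nat \<Rightarrow> nat list \<Rightarrow> (nat \<times> nat) list" where
  "rim_from i [] = []"
| "rim_from i (x # xs) =
     map (Pair i) (rev [(if xs = [] then 1 else hd xs)..<Suc x]) @ rim_from (Suc i) xs"

text \<open>The nodes of the \<open>p\<close>-segments of \<open>L\<close> if the first segment has only \<open>b\<close> nodes.\<close>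

definition segments_union :: "nat \<Rightarrow> nat \<Rightarrow> (nat \<times> nat) list \<Rightarrow> (nat \<times> nat) set" where
  "segments_union p b L = set (take b L) \<union>
     \<Union> (set ` set (p_segments p (filter (\<lambda>w. fst (last (take b L)) < fst w) L)))"

section \<open>The rim and its segments, one row at a time\<close>

lemma is_partition_Cons:
  "is_partition (x # xs) \<longleftrightarrow> 0 < x \<and> (\<forall>y\<in>set xs. y \<le> x) \<and> is_partition xs"
  by (auto simp: is_partition_def)

lemma length_strip [simp]: "length (strip p b l) = length l"
  by (induction p b l rule: strip.induct) (auto simp: Let_def)

lemma rim_from_rows: "w \<in> set (rim_from i l) \<Longrightarrow> i \<le> fst w"
  by (induction i l rule: rim_from.induct) (auto dest: Suc_leD simp del: upt_Suc)

text \<open>In a weakly decreasing list the node diagonally below column j is missing exactly when j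
  is at least the length of the next row. So each row contributes an interval of columns, starting
  at 1 in the last row.\<close>

lemma rim_eq_rim_from:
  assumes "is_partition l"
  shows "rim l = rim_from 1 l"
proof -
  define F where "F i = concat (map (\<lambda>j. if (i + 1, j + 1) \<notin> young_diagram l then [(i, j)] else [])
      (rev [1..<l ! (i - 1) + 1]))" for i
  have row: "F (Suc k) = map (Pair (Suc k))
      (rev [(if Suc k = length l then 1 else l ! Suc k)..<Suc (l ! k)])" if k: "k < length l" for k
  proof -
    define lo where "lo = (if Suc k = length l then 1 else l ! Suc k)"
    have lo: "1 \<le> lo" "lo \<le> l ! k"
      using assms k by (auto simp: lo_def is_partition_def sorted_wrt_iff_nth_less Suc_le_eq)
    have mem: "(Suc k + 1, j + 1) \<notin> young_diagram l \<longleftrightarrow> lo \<le> j" if "1 \<le> j" for j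
      using k that by (auto simp: young_diagram_def lo_def)
    have "F (Suc k) = map (Pair (Suc k)) (filter (\<lambda>j. lo \<le> j) (rev [1..<Suc (l ! k)]))"
    proof -
      have "concat (map (\<lambda>j. if (Suc k + 1, j + 1) \<notin> young_diagram l then [(Suc k, j)] else []) js)
          = map (Pair (Suc k)) (filter (\<lambda>j. lo \<le> j) js)" if "\<forall>j\<in>set js. 1 \<le> j" for js
        using that mem by (induction js) auto
      then show ?thesis unfolding F_def by (simp del: upt_Suc)
    qed
    also have "[1..<Suc (l ! k)] = [1..<lo] @ [lo..<Suc (l ! k)]"
      using lo upt_add_eq_append[of 1 lo "Suc (l ! k) - lo"] by (simp del: upt_Suc)
    also have "filter (\<lambda>j. lo \<le> j) (rev \<dots>) = rev [lo..<Suc (l ! k)]"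
      by (auto simp: rev_filter[symmetric] filter_empty_conv filter_id_conv simp del: upt_Suc)
    finally show ?thesis by (simp add: lo_def)
  qed
  have "concat (map F [Suc k..<Suc (length l)]) = rim_from (Suc k) (drop k l)"
    if "k \<le> length l" for k
    using that
  proof (induction "length l - k" arbitrary: k)
    case 0
    then show ?case by simp
  next
    case (Suc n)
    then have k: "k < length l" by simp
    have "drop k l = l ! k # drop (Suc k) l" using k by (simp add: Cons_nth_drop_Suc)
    moreover have "[Suc k..<Suc (length l)] = Suc k # [Suc (Suc k)..<Suc (length l)]"
      using k by (simp add: upt_conv_Cons del: upt_Suc)
    moreover have "concat (map F [Suc (Suc k)..<Suc (length l)]) = rim_from (Suc (Suc k)) (drop (Suc k) l)"
      using Suc k by (intro Suc.hyps) auto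
    moreover have "(if drop (Suc k) l = [] then 1 else hd (drop (Suc k) l))
       = (if Suc k = length l then 1 else l ! Suc k)"
      using k by (auto simp: hd_drop_conv_nth)
    ultimately show ?case using row[OF k] by (simp del: upt_Suc)
  qed
  from this[of 0] show ?thesis
    by (simp add: rim_def F_def[abs_def] del: upt_Suc)
qed

text \<open>\<open>p_segments\<close> filters only the tail behind the first node,
  \<open>segments_union\<close> the whole list. The first node lies in row \<open>i\<close>, never
  strictly below the end of the segment, so both filters give the same list.\<close>

lemma p_segments_rim_from:
  assumes "0 < p" "is_partition l"
  shows "\<Union> (set ` set (p_segments p (rim_from i l))) = segments_union p p (rim_from i l)"
proof (cases l)
  case (Cons x xs)
  have x: "(if xs = [] then 1 else hd xs) \<le> x"
    using assms(2) by (auto simp: Cons is_partition_Cons)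
  obtain vs where vs: "rim_from i l = (i, x) # vs"
    using x by (simp add: Cons)
  have "last (take p ((i, x) # vs)) \<in> set (take p ((i, x) # vs))"
    using assms(1) by (intro last_in_set) simp
  then have "last (take p ((i, x) # vs)) \<in> set (rim_from i l)"
    unfolding vs by (rule in_set_takeD)
  then have "i \<le> fst (last (take p ((i, x) # vs)))" by (rule rim_from_rows)
  then show ?thesis unfolding vs segments_union_def by (auto simp: Let_def)
qed (simp add: segments_union_def)

lemma set_take_rev_upt:
  assumes "0 < lo" "lo \<le> x" "b \<le> Suc x - lo"
  shows "set (take b (rev [lo..<Suc x])) = {j. x - b < j \<and> j \<le> x}"
  using assms by (cases "b = 0") (auto simp: take_rev simp del: upt_Suc)

text \<open>This is the recursion of \<open>strip\<close>: a segment that ends in the row resets the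
  budget to \<open>p\<close>, otherwise the whole row is used and the rest of the budget passes
  down. If \<open>b = n\<close> the segment counts as ended, so the budget never becomes 0.\<close>

lemma segments_union_rim_from_Cons:
  fixes x i :: nat and xs :: "nat list"
  defines "n \<equiv> Suc x - (if xs = [] then 1 else hd xs)"
  assumes "is_partition (x # xs)" "0 < b" "0 < p"
  shows "segments_union p b (rim_from i (x # xs)) =
    (if b \<le> n then Pair i ` {j. x - b < j \<and> j \<le> x} \<union> segments_union p p (rim_from (Suc i) xs)
     else Pair i ` {j. x - n < j \<and> j \<le> x} \<union> segments_union p (b - n) (rim_from (Suc i) xs))"
proof -
  define lo where "lo = (if xs = [] then 1 else hd xs)"
  define row where "row = map (Pair i) (rev [lo..<Suc x])"
  define rest where "rest = rim_from (Suc i) xs"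
  have lo: "0 < lo" "lo \<le> x"
    using assms(2) by (auto simp: lo_def is_partition_Cons is_partition_def)
  have L: "rim_from i (x # xs) = row @ rest" by (simp add: row_def rest_def lo_def)
  have n: "length row = n" "n = Suc x - lo" by (simp_all add: row_def n_def lo_def del: upt_Suc)
  have rest_rows: "Suc i \<le> fst w" if "w \<in> set rest" for w
    using that rim_from_rows unfolding rest_def by blast
  have row_rows: "fst w = i" if "w \<in> set row" for w using that by (auto simp: row_def simp del: upt_Suc)
  have row_set: "set (take b row) = Pair i ` {j. x - b < j \<and> j \<le> x}" if "b \<le> n" for b
    using set_take_rev_upt[of lo x b] that lo n by (simp add: row_def take_map del: upt_Suc)
  show ?thesis
  proof (cases "b \<le> n")
    case True
    have "take b row \<noteq> []" using assms(3) True n by auto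
    then have "last (take b row) \<in> set row" by (meson in_set_takeD last_in_set)
    then have l: "fst (last (take b row)) = i" by (rule row_rows)
    have f: "filter (\<lambda>w. i < fst w) (row @ rest) = rest"
      using row_rows rest_rows by (auto simp: filter_empty_conv filter_id_conv Suc_le_eq)
    have "is_partition xs" using assms(2) by (simp add: is_partition_Cons)
    then have "\<Union> (set ` set (p_segments p rest)) = segments_union p p rest"
      unfolding rest_def using assms(4) by (intro p_segments_rim_from)
    then show ?thesis
      using True n(1) row_set[OF True] unfolding L rest_def[symmetric]
      by (simp add: segments_union_def[of p b] l f del: filter_append)
  next
    case False
    have t: "take b (row @ rest) = row @ take (b - n) rest" using False n by simp
    have rs: "set row = Pair i ` {j. x - n < j \<and> j \<le> x}" using row_set[of n] n(1) by simp
    show ?thesis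
    \<comment> \<open>Without further rows the segment ends in the current one; otherwise its last
      node lies in \<open>rest\<close>. The split keeps \<open>last\<close> away from the empty
      list.\<close>
    proof (cases "rest = []")
      case True
      have "fst (last row) = i" using n lo by (intro row_rows last_in_set) auto
      then have f: "filter (\<lambda>w. fst (last row) < fst w) row = []"
        using row_rows by (auto simp: filter_empty_conv)
      show ?thesis
        using False t rs f True unfolding L rest_def[symmetric]
        by (simp add: segments_union_def)
    next
      case ne: False
      have ne': "take (b - n) rest \<noteq> []" using ne False by simp
      define w where "w = last (take (b - n) rest)"
      have "w \<in> set rest" unfolding w_def using ne' by (meson in_set_takeD last_in_set)
      then have "Suc i \<le> fst w" by (rule rest_rows)
      then have f: "filter (\<lambda>u. fst w < fst u) row = []"
        using row_rows by (auto simp: filter_empty_conv)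
      have "last (row @ take (b - n) rest) = w" using ne' by (simp add: w_def)
      then show ?thesis
        using False t rs f unfolding L rest_def[symmetric]
        by (simp add: segments_union_def w_def[symmetric] Un_assoc)
    qed
  qed
qed

lemma mem_segments_union:
  assumes "is_partition l" "0 < b" "0 < p"
  shows "(i', j) \<in> segments_union p b (rim_from i l) \<longleftrightarrow>
    (\<exists>k<length l. i' = i + k \<and> strip p b l ! k < j \<and> j \<le> l ! k)"
  using assms(1,2)
proof (induction l arbitrary: b i)
  case (Cons x xs)
  define n where "n = Suc x - (if xs = [] then 1 else hd xs)"
  have P: "is_partition xs" using Cons.prems by (simp add: is_partition_Cons)
  define b' where "b' = (if b \<le> n then p else b - n)"
  have b': "0 < b'" using assms(3) by (simp add: b'_def)
  have s: "strip p b (x # xs) = (x - min b n) # strip p b' xs"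
    by (simp add: n_def b'_def Let_def)
  have "segments_union p b (rim_from i (x # xs)) =
      Pair i ` {j. x - min b n < j \<and> j \<le> x} \<union> segments_union p b' (rim_from (Suc i) xs)"
    using segments_union_rim_from_Cons[OF Cons.prems assms(3), of i]
    by (auto simp: n_def[symmetric] b'_def min_def simp del: rim_from.simps)
  then have "(i', j) \<in> segments_union p b (rim_from i (x # xs)) \<longleftrightarrow>
      i' = i \<and> x - min b n < j \<and> j \<le> x \<or>
      (\<exists>k<length xs. i' = Suc i + k \<and> strip p b' xs ! k < j \<and> j \<le> xs ! k)"
    using Cons.IH[OF P b'] by (auto simp del: rim_from.simps)
  also have "\<dots> \<longleftrightarrow> (\<exists>k<length (x # xs). i' = i + k \<and> strip p b (x # xs) ! k < j \<and> j \<le> (x # xs) ! k)"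
    unfolding s by (auto simp: less_Suc_eq_0_disj)
  finally show ?case .
qed (simp add: segments_union_def)

section \<open>The \<open>p\<close>-rim expressed through \<open>strip\<close>\<close>

lemma mem_p_rim:
  assumes "is_partition l" "0 < p"
  shows "(i, j) \<in> p_rim p l \<longleftrightarrow>
    1 \<le> i \<and> i \<le> length l \<and> strip p p l ! (i - 1) < j \<and> j \<le> l ! (i - 1)"
proof -
  have "p_rim p l = segments_union p p (rim_from 1 l)"
    unfolding p_rim_def rim_eq_rim_from[OF assms(1)] by (intro p_segments_rim_from assms)
  then show ?thesis
    using mem_segments_union[OF assms(1,2,2), of i j 1] by (auto intro: exI[of _ "i - 1"])
qed

lemma strip_nth_le: "k < length l \<Longrightarrow> strip p b l ! k \<le> l ! k"
  by (induction p b l arbitrary: k rule: strip.induct) (auto simp: Let_def nth_Cons split: nat.splits)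

lemma remove_p_rim_eq_strip:
  assumes "is_partition l" "0 < p"
  shows "remove_p_rim p l = filter (\<lambda>n. 0 < n) (strip p p l)"
proof -
  have "card {j. (i, j) \<in> young_diagram l - p_rim p l} = strip p p l ! (i - 1)"
    if "1 \<le> i" "i \<le> length l" for i
  proof -
    have "strip p p l ! (i - 1) \<le> l ! (i - 1)" using that by (intro strip_nth_le) auto
    then have "{j. (i, j) \<in> young_diagram l - p_rim p l} = {1..strip p p l ! (i - 1)}"
      using that by (auto simp: mem_p_rim[OF assms] young_diagram_def)
    then show ?thesis by simp
  qed
  then have "map (\<lambda>i. card {j. (i, j) \<in> young_diagram l - p_rim p l}) [1..<length l + 1] = strip p p l"
    by (intro nth_equalityI) (auto simp del: upt_Suc)
  then show ?thesis by (simp only: remove_p_rim_def)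
qed

lemma card_p_rim_eq_strip:
  assumes "is_partition l" "0 < p"
  shows "int (card (p_rim p l)) = int (sum_list l) - int (sum_list (strip p p l))"
proof -
  let ?S = "strip p p l"
  have "p_rim p l = Sigma {1..length l} (\<lambda>i. {?S ! (i - 1)<..l ! (i - 1)})"
    by (auto simp: mem_p_rim[OF assms])
  then have "card (p_rim p l) = (\<Sum>i=1..length l. l ! (i - 1) - ?S ! (i - 1))"
    by simp
  also have "\<dots> = (\<Sum>i<length l. l ! i - ?S ! i)"
    by (rule sum.reindex_bij_witness[of _ Suc "\<lambda>i. i - 1"]) auto
  finally have "int (card (p_rim p l)) = (\<Sum>i<length l. int (l ! i) - int (?S ! i))"
    by (simp add: of_nat_diff strip_nth_le)
  then show ?thesis
    by (simp add: sum_list_sum_nth sum_subtractf atLeast0LessThan)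
qed

section \<open>JS-partitions as chains of blocks\<close>

text \<open>The congruence for consecutive blocks says that the exit of one is the entry of the
  next. Carrying the required entry \<open>e\<close> as a parameter lets inductions peel off blocks
  from the top; the empty list accepts every entry.\<close>

inductive js_chain :: "nat \<Rightarrow> int \<Rightarrow> nat list \<Rightarrow> bool" for p where
  Nil: "js_chain p e []"
| block: "js_chain p e (replicate a x @ r)"
    if "0 < a" "a < p" "0 < x" "[int x - int a = e] (mod int p)" "\<forall>y\<in>set r. y < x"
      "js_chain p (int x + int a) r"

text \<open>The last column of a residue symbol, in terms of the last exit \<open>w\<close> of the smaller partition, the
  number \<open>s\<close> of parts that disappear and the size \<open>k\<close> of the \<open>p\<close>-rim.\<close>

definition extension :: "nat \<Rightarrow> int \<Rightarrow> int \<Rightarrow> int \<Rightarrow> bool" where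
  "extension p w s k \<longleftrightarrow>
     [k = 0] (mod int p) \<and> ([s = 0] (mod int p) \<or> [s = - w] (mod int p)) \<or>
     [s = 1] (mod int p) \<and> [k = w + 1] (mod int p) \<or>
     [k = s] (mod int p) \<and> [s = 1 - w] (mod int p)"

section \<open>Congruences and handling of single blocks\<close>

lemma sorted_wrt_replicate: "sorted_wrt (\<ge>) (replicate a (x :: nat))"
  by (induction a) auto

lemma count_list_replicate: "count_list (replicate a x) y = (if x = y then a else 0)"
  by (induction a) auto

lemma cong_if_diff_eq: "a - b = p \<Longrightarrow> [a = b] (mod p)" for a b p :: int
  by (auto simp: cong_iff_dvd_diff)

lemma extension_cong:
  assumes "extension p w s k" "[w = w'] (mod int p)" "[k = k'] (mod int p)"
  shows "extension p w' s k'"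
proof -
  note d = assms(2,3)[unfolded cong_iff_dvd_diff]
  have "int p dvd k \<Longrightarrow> int p dvd k'" using d by algebra
  moreover have "int p dvd s - (- w) \<Longrightarrow> int p dvd s - (- w')" using d by algebra
  moreover have "int p dvd k - (w + 1) \<Longrightarrow> int p dvd k' - (w' + 1)" using d by algebra
  moreover have "int p dvd k - s \<Longrightarrow> int p dvd k' - s" using d by algebra
  moreover have "int p dvd s - (1 - w) \<Longrightarrow> int p dvd s - (1 - w')" using d by algebra
  ultimately show ?thesis using assms(1) unfolding extension_def cong_iff_dvd_diff diff_0_right by blast
qed

lemma cong_bounded_eq:
  fixes a b p :: int
  assumes "[a = b] (mod p)" "a - b < p" "b - a < p"
  shows "a = b"
proof (rule ccontr)
  assume "a \<noteq> b"
  moreover have "p dvd a - b" "p dvd b - a" using assms(1) by (auto simp: cong_iff_dvd_diff dvd_diff_commute)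
  ultimately show False using assms(2,3) zdvd_imp_le[of p "a - b"] zdvd_imp_le[of p "b - a"] by linarith
qed

lemma p_regular_appendD: "p_regular p (xs @ ys) \<Longrightarrow> p_regular p ys"
  by (auto simp: p_regular_def is_partition_def sorted_wrt_append) (metis UnCI add_leE)

lemma js_chain_cong:
  assumes "js_chain p e l" "[e = e'] (mod int p)"
  shows "js_chain p e' l"
  using assms(1)
proof cases
  case (block a x r)
  then show ?thesis using assms(2) by (auto intro!: js_chain.block intro: cong_trans)
qed (simp add: js_chain.Nil)

text \<open>An empty block has equal entry and exit, so it may be inserted freely. This covers the
  block with \<open>a - 1\<close> rows left over from a block with \<open>a = 1\<close>.\<close>

lemma js_chain_replicate:
  assumes "a < p" "0 < a \<Longrightarrow> 0 < x" "[int x - int a = e] (mod int p)"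
    "0 < a \<Longrightarrow> \<forall>y\<in>set r. y < x" "js_chain p (int x + int a) r"
  shows "js_chain p e (replicate a x @ r)"
  using assms by (cases "a = 0") (auto intro: js_chain.block js_chain_cong)

lemma js_chain_regular: "js_chain p e l \<Longrightarrow> p_regular p l"
proof (induction rule: js_chain.induct)
  case (block a x e r)
  have "count_list (replicate a x @ r) y \<le> p - 1" if "y \<in> set (replicate a x @ r)" for y
  proof (cases "y = x")
    case True
    have "x \<notin> set r" using block by auto
    then show ?thesis using block True by (simp add: count_list_replicate count_list_0_iff)
  next
    case False
    then have "count_list (replicate a x) y = 0" by (simp add: count_list_0_iff)
    then show ?thesis using block that False by (auto simp: p_regular_def)
  qed
  then show ?case using block
    by (auto simp: p_regular_def is_partition_def sorted_wrt_append sorted_wrt_replicate less_imp_le)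
qed (simp add: p_regular_def is_partition_def)

lemma partition_blockE:
  assumes "is_partition l" "l \<noteq> []"
  obtains a x r where "l = replicate a x @ r" "0 < a" "0 < x" "\<forall>y\<in>set r. y < x" "is_partition r"
proof -
  define x where "x = hd l"
  define t where "t = takeWhile (\<lambda>y. y = x) l"
  define r where "r = dropWhile (\<lambda>y. y = x) l"
  have l: "l = t @ r" by (simp add: t_def r_def)
  have t: "t = replicate (length t) x"
    by (rule replicate_eqI) (auto simp: t_def dest: set_takeWhileD)
  have P: "is_partition r" using assms(1) unfolding l by (simp add: is_partition_def sorted_wrt_append)
  have "0 < length t" using assms(2) by (cases l) (auto simp: t_def x_def)
  moreover have "0 < x" using assms by (auto simp: is_partition_def x_def)
  moreover have "\<forall>y\<in>set r. y < x"
  proof (cases r)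
    case (Cons z zs)
    have "hd (dropWhile (\<lambda>y. y = x) l) \<noteq> x"
      using hd_dropWhile[of "\<lambda>y. y = x" l] Cons unfolding r_def by (metis list.distinct(1))
    then have "z \<noteq> x" using Cons by (simp add: r_def)
    moreover have "\<forall>y\<in>set r. y \<le> x"
      using assms unfolding l by (cases t) (auto simp: is_partition_def x_def l Cons sorted_wrt_append)
    ultimately show ?thesis using P Cons by (auto simp: is_partition_Cons)
  qed simp
  ultimately show ?thesis using that[of "length t" x r] l t P by metis
qed

lemma exponential_form_block:
  assumes "0 < a" "x \<notin> set r"
  shows "exponential_form (replicate a x @ r) = (x, a) # exponential_form r"
proof -
  have "remdups (replicate a x @ r) = x # remdups r"
    using assms(1)
  proof (induction a)
    case (Suc a)
    then show ?case using assms(2) by (cases "a = 0") auto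
  qed simp
  moreover have "count_list (replicate a x) y = 0" if "y \<in> set r" for y
    using assms that by (auto simp: count_list_0_iff)
  ultimately show ?thesis using assms by (simp add: exponential_form_def count_list_replicate count_list_0_iff)
qed

text \<open>Peeling off the first block \<open>(x, a)\<close> leaves a JS-partition of type
  \<open>x + a\<close>: the congruence between the first two blocks is precisely the type condition
  for the rest.\<close>

lemma JS_partition_iff_js_chain:
  assumes "2 \<le> p"
  shows "JS_partition_of_type p e l \<longleftrightarrow> l \<noteq> [] \<and> js_chain p e l"
proof
  show "l \<noteq> [] \<and> js_chain p e l" if "JS_partition_of_type p e l"
    using that
  proof (induction "length l" arbitrary: l e rule: less_induct)
    case less
    then have P: "p_regular p l" "l \<noteq> []" by (auto simp: JS_partition_of_type_def JS_partition_def)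
    then obtain a x r where b: "l = replicate a x @ r" "0 < a" "0 < x" "\<forall>y\<in>set r. y < x" "is_partition r"
      using partition_blockE unfolding p_regular_def by metis
    have xr: "x \<notin> set r" using b(4) by auto
    note E = exponential_form_block[OF b(2) xr]
    have a: "a < p" using P b xr assms by (auto simp: p_regular_def count_list_replicate count_list_0_iff)
    have e: "[int x - int a = e] (mod int p)"
      using less.prems by (simp add: JS_partition_of_type_def b(1) E)
    have "js_chain p (int x + int a) r"
    proof (cases "r = []")
      case False
      have "p_regular p r" using P b(1) p_regular_appendD by blast
      obtain x' a' E' where E': "exponential_form r = (x', a') # E'"
        using False by (cases "exponential_form r") (auto simp: exponential_form_def)
      have J: "\<forall>i. Suc i < length (exponential_form l) \<longrightarrow>
        [int (fst (exponential_form l ! i)) - int (fst (exponential_form l ! Suc i)) +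
         int (snd (exponential_form l ! i)) + int (snd (exponential_form l ! Suc i)) = 0] (mod int p)"
        using less.prems by (simp add: JS_partition_of_type_def JS_partition_def Let_def)
      from J[rule_format, of 0] have "[int x - int x' + int a + int a' = 0] (mod int p)"
        by (simp add: b(1) E E')
      then have "[int x' - int a' = int x + int a] (mod int p)"
        unfolding cong_iff_dvd_diff by algebra
      moreover have "JS_partition p r"
        unfolding JS_partition_def Let_def
        using \<open>p_regular p r\<close> J[rule_format, of "Suc i" for i] by (simp add: b(1) E)
      ultimately have "JS_partition_of_type p (int x + int a) r"
        using False E' by (simp add: JS_partition_of_type_def)
      then show ?thesis using less.hyps[of r] b by simp
    qed (simp add: js_chain.Nil)
    then show ?case using P b a e js_chain.block by blast
  qed
next
  assume "l \<noteq> [] \<and> js_chain p e l"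
  then have "js_chain p e l" "l \<noteq> []" by auto
  then show "JS_partition_of_type p e l"
  proof (induction rule: js_chain.induct)
    case (block a x e r)
    have xr: "x \<notin> set r" using block by auto
    note E = exponential_form_block[OF \<open>0 < a\<close> xr]
    have reg: "p_regular p (replicate a x @ r)"
      using block by (intro js_chain_regular js_chain.block)
    have "JS_partition p (replicate a x @ r)"
    proof (cases "r = []")
      case True
      then show ?thesis using reg E by (simp add: JS_partition_def exponential_form_def)
    next
      case False
      then have J: "JS_partition_of_type p (int x + int a) r" by (rule block.IH)
      obtain x' a' E' where E': "exponential_form r = (x', a') # E'"
        using False by (cases "exponential_form r") (auto simp: exponential_form_def)
      have "[int x' - int a' = int x + int a] (mod int p)"
        using J by (simp add: JS_partition_of_type_def E')
      then have "[int x - int x' + int a + int a' = 0] (mod int p)"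
        unfolding cong_iff_dvd_diff by algebra
      then show ?thesis using J reg unfolding JS_partition_of_type_def JS_partition_def Let_def E
        by (auto simp: nth_Cons E' split: nat.split)
    qed
    then show ?case using block by (simp add: JS_partition_of_type_def E)
  qed simp
qed

text \<open>Regularity replaces strict descent to the next block. If the next part were again
  \<open>x\<close>, with multiplicity \<open>a'\<close>, then exit and entry would match only if
  \<open>p\<close> divides \<open>a + a'\<close>, but \<open>p\<close>-regularity gives
  \<open>0 < a + a' < p\<close>.\<close>

lemma js_chain_replicate_regular:
  assumes "p_regular p (replicate a x @ r)" "[int x - int a = e] (mod int p)" "2 \<le> p"
    "js_chain p (int x + int a) r"
  shows "js_chain p e (replicate a x @ r)"
proof (cases "a = 0")
  case True
  then show ?thesis using assms js_chain_cong by simp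
next
  case False
  have le: "\<forall>y\<in>set r. y \<le> x" "0 < x"
    using assms(1) False by (auto simp: p_regular_def is_partition_def sorted_wrt_append)
  have c: "a + count_list r x \<le> p - 1"
    using assms(1) False by (auto simp: p_regular_def count_list_replicate)
  have "x \<notin> set r"
  proof
    assume x: "x \<in> set r"
    from assms(4) show False
    proof cases
      case (block a' x' r')
      then have "x' \<le> x" "x \<le> x'" using le x by auto
      then have "x' = x" by simp
      then have "a + a' < p" using c block by (auto simp: count_list_replicate)
      moreover have "int p dvd int a + int a'"
        using block(5) unfolding \<open>x' = x\<close> cong_iff_dvd_diff by algebra
      ultimately show False using False zdvd_imp_le[of "int p" "int a + int a'"] by simp
    qed (use x in simp)
  qed
  then have "\<forall>y\<in>set r. y < x" using le(1) by (metis le_neq_implies_less)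
  then show ?thesis using assms c le False by (intro js_chain.block) auto
qed

section \<open>Removing the \<open>p\<close>-rim of a JS-partition\<close>

text \<open>Every row contains a rim node and the budget is positive, so each row loses at least one
  node.\<close>

lemma strip_bounded:
  assumes "is_partition m" "0 < b" "0 < p" "\<forall>x\<in>set m. x \<le> c" "y \<in> set (strip p b m)"
  shows "y < c"
  using assms
proof (induction p b m rule: strip.induct)
  case (2 p b x xs)
  define n where "n = Suc x - (if xs = [] then 1 else hd xs)"
  have n: "0 < n" "0 < x" using 2(3) by (auto simp: n_def is_partition_Cons less_Suc_eq_le)
  have "is_partition xs" using 2 by (simp add: is_partition_Cons)
  then show ?case
    using 2 n by (auto simp: n_def[symmetric] Let_def split: if_splits)
qed simp

text \<open>All rows of a block except its lowest have exactly one rim node, so each of them costs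
  one unit of the budget.\<close>

lemma strip_replicate:
  "a < b \<Longrightarrow> strip p b (replicate (Suc a) x @ r) = replicate a (x - 1) @ strip p (b - a) (x # r)"
proof (induction a arbitrary: b)
  case (Suc a)
  have "strip p b (x # (replicate (Suc a) x @ r)) = (x - 1) # strip p (b - 1) (replicate (Suc a) x @ r)"
    using Suc.prems by simp
  then show ?case using Suc.IH[of "b - 1"] Suc.prems by simp
qed simp

text \<open>Induction on the top block or pair of blocks. The number
  \<open>e + 2 * int (length l)\<close> is the last exit of \<open>l\<close>: a block with
  \<open>a\<close> rows leads from \<open>x - a\<close> to \<open>x + a\<close>.\<close>

lemma js_chain_strip:
  assumes "2 \<le> p" "js_chain p e m"
  shows "\<exists>l s. strip p p m = l @ replicate s 0 \<and> js_chain p e l \<and>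
    extension p (e + 2 * int (length l)) (int s) (int (sum_list m) - int (sum_list l))"
  using assms(2)
proof (induction "length m" arbitrary: m e rule: less_induct)
  case less
  from less.prems show ?case
  proof cases
    case Nil
    then show ?thesis by (auto intro!: exI[of _ "[]"] js_chain.Nil simp: extension_def)
  next
    case (block a x r)
    have Pr: "is_partition r" using js_chain_regular[OF block(7)] by (simp add: p_regular_def)
    \<comment> \<open>The budget that reaches the lowest row of the first block.\<close>
    define B where "B = p - (a - 1)"
    have B: "2 \<le> B" "B + a = p + 1" using block by (auto simp: B_def)
    obtain a0 where a0: "a = Suc a0" using block gr0_conv_Suc by blast
    have st: "strip p p m = replicate a0 (x - 1) @ strip p B (x # r)"
      using strip_replicate[of a0 p p x r] block by (simp add: a0 B_def)
    have e: "[e = int x - int a] (mod int p)" using block(5) by (simp add: cong_sym_eq)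
    \<comment> \<open>The upper \<open>a - 1\<close> rows become a block with part
      \<open>x - 1\<close>, entry \<open>x - a\<close> and exit \<open>x + a - 2\<close>. Hence the
      remainder \<open>t\<close> has to start at \<open>x + a - 2\<close>; \<open>1 < x\<close>
      keeps the upper rows nonzero.\<close>
    have lift: ?thesis if t: "strip p B (x # r) = t @ replicate s 0" "1 < x"
      "js_chain p (int x + int a - 2) t" "\<forall>y\<in>set t. y < x - 1"
      "extension p (int x + int a - 2 + 2 * int (length t)) (int s)
         (int a0 + int x + int (sum_list r) - int (sum_list t))" for t s
    proof -
      have "[int (x - 1) - int a0 = e] (mod int p)"
        using e t(2) by (simp add: a0 of_nat_diff cong_sym_eq algebra_simps)
      moreover have "js_chain p (int (x - 1) + int a0) t"
        using t(2,3) by (simp add: a0 of_nat_diff algebra_simps)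
      ultimately have "js_chain p e (replicate a0 (x - 1) @ t)"
        using t a0 block by (intro js_chain_replicate) auto
      moreover have "extension p (e + 2 * int (length (replicate a0 (x - 1) @ t))) (int s)
          (int (sum_list m) - int (sum_list (replicate a0 (x - 1) @ t)))"
      proof (rule extension_cong[OF t(5)])
        show "[int x + int a - 2 + 2 * int (length t)
            = e + 2 * int (length (replicate a0 (x - 1) @ t))] (mod int p)"
          using e unfolding cong_iff_dvd_diff a0 length_append length_replicate of_nat_add of_nat_Suc
          by algebra
        have "int (sum_list m) - int (sum_list (replicate a0 (x - 1) @ t))
            = int a0 + int x + int (sum_list r) - int (sum_list t)"
          using t(2) by (cases x) (simp_all add: block(1) a0 sum_list_replicate algebra_simps)
        then show "[int a0 + int x + int (sum_list r) - int (sum_list t)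
            = int (sum_list m) - int (sum_list (replicate a0 (x - 1) @ t))] (mod int p)"
          by (simp only: cong_refl)
      qed
      ultimately show ?thesis using st t(1) by (metis append.assoc)
    qed
    show ?thesis
    proof (cases "r = []")
      case r: True
      \<comment> \<open>With w the last exit of the remainder: \<open>full\<close> gives s = 1 = -w
        with k = 0, \<open>long\<close> gives s = k = 0, and \<open>short\<close> gives s = 1 with k
        = w + 1, all modulo \<open>p\<close>. In \<open>ones\<close> the whole block vanishes, so s
        = k = 1 - w, and \<open>lift\<close> does not apply.\<close>
      consider (full) "B = x" | (long) "B < x" | (ones) "x < B" "x = 1" | (short) "x < B" "1 < x"
        using \<open>0 < x\<close> by linarith
      then show ?thesis
      proof cases
        case full
        have "int x + int a = int p + 1" using full B by simp
        then have "[1 = - (int x + int a - 2)] (mod int p)" "[int a0 + int x = 0] (mod int p)"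
          by (auto intro!: cong_if_diff_eq simp: a0)
        then show ?thesis
          using full B r by (intro lift[of "[]" 1]) (auto simp: js_chain.Nil extension_def)
      next
        case long
        have x: "int (x - B) = int x + int a - 1 - int p" using long B by linarith
        have "js_chain p (int x + int a - 2) (replicate 1 (x - B) @ [])"
        proof (rule js_chain_replicate)
          show "[int (x - B) - int 1 = int x + int a - 2] (mod int p)"
            unfolding x cong_iff_dvd_diff of_nat_1 by algebra
        qed (use long assms(1) in \<open>auto simp: js_chain.Nil\<close>)
        moreover have "[int a0 + int x - int (x - B) = 0] (mod int p)"
          unfolding x a0 of_nat_Suc cong_iff_dvd_diff by algebra
        ultimately show ?thesis
          using long B r by (intro lift[of "[x - B]" 0]) (auto simp: extension_def)
      next
        case ones
        have "strip p p m = [] @ replicate a 0"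
          using st ones r by (simp add: a0 replicate_append_same)
        moreover have "[int a = 1 - e] (mod int p)"
          using e ones unfolding cong_iff_dvd_diff by (simp add: algebra_simps)
        ultimately show ?thesis
          using ones r by (intro exI[of _ "[]"] exI[of _ a])
            (auto simp: js_chain.Nil extension_def block(1) sum_list_replicate)
      next
        case short
        then show ?thesis
          using r by (intro lift[of "[]" 1]) (auto simp: js_chain.Nil extension_def a0 add.commute)
      qed
    next
      case False
      with block(7) obtain a' x' r' where b':
        "r = replicate a' x' @ r'" "0 < a'" "a' < p" "0 < x'"
        "[int x' - int a' = int x + int a] (mod int p)" "\<forall>y\<in>set r'. y < x'"
        "js_chain p (int x' + int a') r'"
        by cases auto
      obtain a0' where a0': "a' = Suc a0'" using b' gr0_conv_Suc by blast
      have x': "x' < x" "x' \<in> set r" using block b' by auto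
      have hd: "hd r = x'" using b' by (simp add: a0')
      define n where "n = Suc x - x'"
      have st2: "strip p B (x # r)
          = (if B \<le> n then (x - B) # strip p p r else (x - n) # strip p (B - n) r)"
        using False hd by (simp add: n_def Let_def)
      show ?thesis
      proof (cases "B \<le> n")
        case True
        then have Bx: "B \<le> x" using b'(4) by (simp add: n_def)
        obtain t s where t: "strip p p r = t @ replicate s 0" "js_chain p (int x + int a) t"
          "extension p (int x + int a + 2 * int (length t)) (int s) (int (sum_list r) - int (sum_list t))"
          using less.hyps[of r "int x + int a"] block by auto
        have x: "int (x - B) = int x + int a - 1 - int p"
          using Bx B by linarith
        \<comment> \<open>In this borderline case the shortened row would be only
          \<open>x' - 1\<close>, and strict descent could fail. The entry condition would then force
          \<open>p\<close> to divide \<open>a'\<close>.\<close>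
        have "x' \<noteq> Suc (x - B)"
        proof
          assume "x' = Suc (x - B)"
          then have eq: "int x' = int x + int a - int p" using x by simp
          have "int p dvd int a'" using b'(5) unfolding eq cong_iff_dvd_diff by algebra
          then show False using b' zdvd_imp_le[of "int p" "int a'"] by simp
        qed
        then have big: "x' \<le> x - B" using True Bx x' unfolding n_def by linarith
        have "\<forall>y\<in>set r. y \<le> x'" using b' by (auto simp: less_imp_le)
        then have "\<forall>y\<in>set (strip p p r). y < x'"
          using strip_bounded[OF Pr, of p p x'] assms(1) by auto
        then have t': "\<forall>y\<in>set t. y < x - B" using t(1) big by (auto intro: less_le_trans)
        \<comment> \<open>The shortened row is a block of its own with entry
          \<open>x + a - 2\<close> and exit \<open>x + a\<close> modulo \<open>p\<close>, so the
          chain from the induction hypothesis fits below it.\<close>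
        have "js_chain p (int x + int a - 2) (replicate 1 (x - B) @ t)"
        proof (rule js_chain_replicate)
          show "[int (x - B) - int 1 = int x + int a - 2] (mod int p)"
            unfolding x cong_iff_dvd_diff of_nat_1 by algebra
          show "js_chain p (int (x - B) + int 1) t"
            by (rule js_chain_cong[OF t(2)]) (unfold x cong_iff_dvd_diff of_nat_1, algebra)
        qed (use t' big b' assms(1) in auto)
        moreover have "extension p (int x + int a - 2 + 2 * int (length ((x - B) # t))) (int s)
            (int a0 + int x + int (sum_list r) - int (sum_list ((x - B) # t)))"
          using t(3)
        proof (rule extension_cong)
          show "[int (sum_list r) - int (sum_list t)
              = int a0 + int x + int (sum_list r) - int (sum_list ((x - B) # t))] (mod int p)"
            unfolding sum_list.Cons of_nat_add x a0 of_nat_Suc cong_iff_dvd_diff by algebra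
        qed (simp add: algebra_simps)
        moreover have "\<forall>y\<in>set ((x - B) # t). y < x - 1" using t' B big b' x' by auto
        ultimately show ?thesis
          using True st2 t(1) b' x' by (intro lift[of "(x - B) # t" s]) auto
      next
        case pair: False
        \<comment> \<open>The left side is divisible by \<open>p\<close> by the JS condition; it is
          positive, and below \<open>2p\<close> because the budget outlasts the first block and
          \<open>a' < p\<close>.\<close>
        have "int x - int x' + int a + int a' = int p"
        proof -
          have "[int x - int x' + int a + int a' = int p] (mod int p)"
            using b'(5) unfolding cong_iff_dvd_diff by algebra
          then show ?thesis
            using pair B x' b' block by (intro cong_bounded_eq) (auto simp: n_def of_nat_diff)
        qed
        then have sum: "x + a + a' = p + x'" by linarith
        \<comment> \<open>The budget entering the second block is its number of rows. Each row loses
          one node and the segment ends in the lowest one, while the row above has shrunk to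
          \<open>x' - 1\<close> and joins the block.\<close>
        have Bn: "B - n = a'" using sum B x' by (simp add: n_def)
        have n1: "1 \<le> Suc x' - (if r' = [] then 1 else hd r')" using b'(4,6) by (cases r') auto
        have "strip p a' r = replicate a0' (x' - 1) @ strip p 1 (x' # r')"
          using strip_replicate[of a0' a' p x' r'] by (simp add: b'(1) a0')
        also have "strip p 1 (x' # r') = (x' - 1) # strip p p r'"
          using n1 by (simp add: Let_def)
        finally have st3: "strip p B (x # r) = replicate (Suc a') (x' - 1) @ strip p p r'"
          using pair x' Bn st2 by (simp add: n_def a0' replicate_append_same)
        show ?thesis
        \<comment> \<open>If \<open>x' = 1\<close> the enlarged lower block of \<open>a' + 1\<close>
          rows vanishes, giving s = -w and k = 0 modulo \<open>p\<close>.\<close>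
        proof (cases "x' = 1")
          case True
          then have r': "r' = []" using b' js_chain_regular[OF b'(7)]
            by (cases r') (auto simp: p_regular_def is_partition_def)
          have "int x + int a + int a' = int p + 1" using sum True by linarith
          then have "[1 + int a' = - (int x + int a - 2)] (mod int p)"
            "[int a0 + int x + int a' = 0] (mod int p)"
            by (auto intro!: cong_if_diff_eq simp: a0)
          then show ?thesis
            using st3 True r' x' b'(1)
            by (intro lift[of "[]" "Suc a'"]) (auto simp: js_chain.Nil extension_def sum_list_replicate)
        next
          case False
          then have x'2: "2 \<le> x'" using b' by simp
          obtain t s where t: "strip p p r' = t @ replicate s 0" "js_chain p (int x' + int a') t"
            "extension p (int x' + int a' + 2 * int (length t)) (int s) (int (sum_list r') - int (sum_list t))"
            using less.hyps[of r' "int x' + int a'"] block b' by auto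
          have "is_partition r'" using js_chain_regular[OF b'(7)] by (simp add: p_regular_def)
          moreover have "\<forall>y\<in>set r'. y \<le> x' - 1" using b' by auto
          ultimately have "\<forall>y\<in>set (strip p p r'). y < x' - 1"
            using strip_bounded[of r' p p "x' - 1"] assms(1) by auto
          then have t': "\<forall>y\<in>set t. y < x' - 1" using t(1) by auto
          let ?t = "replicate (Suc a') (x' - 1) @ t"
          have sum': "int x + int a + int a' = int p + int x'" using sum by linarith
          have x1: "int (x' - 1) = int x' - 1" using x'2 by simp
          have "js_chain p (int x + int a - 2) ?t"
          proof (rule js_chain_replicate)
            show "[int (x' - 1) - int (Suc a') = int x + int a - 2] (mod int p)"
              using b'(5) unfolding x1 cong_iff_dvd_diff of_nat_Suc by algebra
            show "js_chain p (int (x' - 1) + int (Suc a')) t"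
              by (rule js_chain_cong[OF t(2)]) (unfold x1, simp)
            show "Suc a' < p" using sum x' block by linarith
          qed (use t' x'2 in auto)
          moreover have "extension p (int x + int a - 2 + 2 * int (length ?t)) (int s)
              (int a0 + int x + int (sum_list r) - int (sum_list ?t))"
            using t(3)
          proof (rule extension_cong)
            show "[int x' + int a' + 2 * int (length t)
                = int x + int a - 2 + 2 * int (length ?t)] (mod int p)"
              using b'(5) unfolding length_append length_replicate of_nat_add of_nat_Suc cong_iff_dvd_diff
              by algebra
            have "int (sum_list ?t) = (1 + int a') * (int x' - 1) + int (sum_list t)"
              using x'2 by (cases x') (simp_all add: sum_list_replicate algebra_simps)
            moreover have "int (sum_list r) = int a' * int x' + int (sum_list r')"
              by (simp add: b'(1) sum_list_replicate)
            ultimately have "int a0 + int x + int (sum_list r) - int (sum_list ?t)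
              = int (sum_list r') - int (sum_list t) + int p"
              using sum' by (simp add: a0 algebra_simps)
            then show "[int (sum_list r') - int (sum_list t)
                = int a0 + int x + int (sum_list r) - int (sum_list ?t)] (mod int p)"
              by (simp only: cong_def mod_add_self2)
          qed
          moreover have "\<forall>y\<in>set ?t. y < x - 1" using t' x'2 x' by auto
          ultimately show ?thesis
            using st3 t(1) x'2 x' by (intro lift[of ?t s]) auto
        qed
      qed
    qed
  qed
qed

section \<open>Restoring the \<open>p\<close>-rim\<close>

text \<open>Inversion of one row. If the segment stops there, \<open>z\<close> is determined by
  \<open>x\<close> and \<open>b\<close>; if it passes on, the rim part of the row starts at the
  length of the next row, which must be \<open>Suc x\<close>, or the row was the last and
  vanished.\<close>

lemma strip_ConsE:
  assumes "is_partition m" "0 < b" "b \<le> p" "strip p b m = x # t"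
  obtains z m' b' where "m = z # m'" "x < z" "strip p b' m' = t" "0 < b'" "b' \<le> p"
    "\<forall>y\<in>set m'. y \<le> Suc x"
    "b' = p \<and> z = x + b \<or> b' < p \<and> z + b' = x + b \<and> (if m' = [] then x = 0 else hd m' = Suc x)"
proof -
  obtain z m' where m: "m = z # m'" using assms(4) by (cases m) auto
  define n where "n = Suc z - (if m' = [] then 1 else hd m')"
  have P: "is_partition m'" "0 < z" "\<forall>y\<in>set m'. y \<le> z" using assms(1) by (auto simp: m is_partition_Cons)
  have h: "m' \<noteq> [] \<Longrightarrow> 0 < hd m' \<and> hd m' \<le> z" using P by (auto simp: is_partition_def)
  have n: "0 < n" "n \<le> z" using P(2) h by (auto simp: n_def less_Suc_eq_le)
  have le: "\<forall>y\<in>set m'. y \<le> hd m'" using P(1) by (cases m') (auto simp: is_partition_Cons)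
  show thesis
  proof (cases "b \<le> n")
    case True
    then have x: "x = z - b" "strip p p m' = t" using assms(4) by (auto simp: m n_def)
    have "hd m' \<le> Suc x" if "m' \<noteq> []"
      using True x(1) h[OF that] that by (auto simp: n_def)
    then have "\<forall>y\<in>set m'. y \<le> Suc x" using le by fastforce
    then show thesis using x True n assms by (intro that[of z m' p]) (auto simp: m)
  next
    case False
    then have x: "x = z - n" "strip p (b - n) m' = t" using assms(4) by (auto simp: m n_def Let_def)
    then have hx: "if m' = [] then x = 0 else hd m' = Suc x" using h n by (auto simp: n_def)
    then have "\<forall>y\<in>set m'. y \<le> Suc x" using le by (cases "m' = []") auto
    then show thesis using x hx False n assms by (intro that[of z m' "b - n"]) (auto simp: m)
  qed
qed

text \<open>All rows after the first are squeezed to \<open>Suc x\<close> and lose one node each.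
  Since there are fewer than \<open>p\<close> rows, at most one segment ends among them: in the
  lowest row (\<open>b' = p\<close>), nowhere, or in the \<open>i\<close>-th row, after which a new
  segment starts.\<close>

lemma strip_replicateE:
  assumes "is_partition m" "0 < b" "b \<le> p" "strip p b m = replicate (Suc a) x @ t" "Suc a < p"
  shows "\<exists>z m' b'. m = z # replicate a (Suc x) @ m' \<and> x < z \<and> strip p b' m' = t \<and> 0 < b' \<and> b' \<le> p \<and>
    (b' = p \<and> z + a = x + b \<or>
     b' < p \<and> (if m' = [] then x = 0 else hd m' = Suc x) \<and>
       (z + a + b' = x + b \<or> (\<exists>i. 1 \<le> i \<and> i \<le> a \<and> b' + Suc a = p + i \<and> z + i = Suc (x + b))))"
  using assms
proof (induction a arbitrary: b m)
  case 0
  then have "strip p b m = x # t" by simp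
  from strip_ConsE[OF 0(1-3) this] obtain z m' b' where
    "m = z # m'" "x < z" "strip p b' m' = t" "0 < b'" "b' \<le> p"
    "b' = p \<and> z = x + b \<or> b' < p \<and> z + b' = x + b \<and> (if m' = [] then x = 0 else hd m' = Suc x)" .
  then show ?case by (intro exI[of _ z] exI[of _ m'] exI[of _ b']) auto
next
  case (Suc a)
  have "strip p b m = x # (replicate (Suc a) x @ t)" using Suc.prems by simp
  from strip_ConsE[OF Suc.prems(1-3) this] obtain z m1 b1 where z: "m = z # m1" "x < z" "strip p b1 m1 = replicate (Suc a) x @ t"
    "0 < b1" "b1 \<le> p" "\<forall>y\<in>set m1. y \<le> Suc x"
    "b1 = p \<and> z = x + b \<or> b1 < p \<and> z + b1 = x + b \<and> (if m1 = [] then x = 0 else hd m1 = Suc x)" .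
  have "is_partition m1" using Suc.prems(1) by (simp add: z is_partition_Cons)
  from Suc.IH[OF this z(4,5,3)] Suc.prems(5) obtain z1 m' b' where z1:
    "m1 = z1 # replicate a (Suc x) @ m'" "x < z1" "strip p b' m' = t" "0 < b'" "b' \<le> p"
    "b' = p \<and> z1 + a = x + b1 \<or>
     b' < p \<and> (if m' = [] then x = 0 else hd m' = Suc x) \<and>
       (z1 + a + b' = x + b1 \<or> (\<exists>i. 1 \<le> i \<and> i \<le> a \<and> b' + Suc a = p + i \<and> z1 + i = Suc (x + b1)))"
    by auto
  have zx: "z1 = Suc x" using z(6) z1 by auto
  have m: "m = z # replicate (Suc a) (Suc x) @ m'" using z z1 zx by simp
  have "b' = p \<and> z + Suc a = x + b \<or>
     b' < p \<and> (if m' = [] then x = 0 else hd m' = Suc x) \<and>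
       (z + Suc a + b' = x + b \<or>
        (\<exists>i. 1 \<le> i \<and> i \<le> Suc a \<and> b' + Suc (Suc a) = p + i \<and> z + i = Suc (x + b)))"
  proof (cases "b1 = p")
    case True
    then have "z = x + b" using z(7) by auto
    then show ?thesis using z1(6) True zx Suc.prems(5) by (auto intro: exI[of _ 1])
  next
    case False
    then have zb: "z + b1 = x + b" using z(7) by auto
    from z1(6) show ?thesis
    proof (elim disjE conjE exE)
      fix i assume "1 \<le> i" "i \<le> a" "b' + Suc a = p + i" "z1 + i = Suc (x + b1)"
        "b' < p" "if m' = [] then x = 0 else hd m' = Suc x"
      then show ?thesis using zb zx by (intro disjI2 conjI exI[of _ "Suc i"]) auto
    qed (use zb zx in auto)
  qed
  then show ?case using m z(2) z1(3-5) by blast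
qed

lemma strip_zerosE:
  assumes "is_partition m" "0 < b" "b \<le> p" "strip p b m = replicate s 0" "m \<noteq> []"
  obtains z where "m = z # replicate (s - 1) 1" "0 < z" "z \<le> b" "0 < s"
proof -
  have s: "s = length m" using assms(4) by (metis length_replicate length_strip)
  then have s0: "0 < s" using assms(5) by simp
  then have "strip p b m = 0 # replicate (s - 1) 0" using assms(4) by (cases s) auto
  from strip_ConsE[OF assms(1-3) this] obtain z m' where z:
    "m = z # m'" "0 < z" "\<forall>y\<in>set m'. y \<le> 1" "z \<le> b" by (metis One_nat_def add_0 le_add1 le_refl)
  have "m' = replicate (s - 1) 1"
    using z assms(1) s by (intro replicate_eqI) (auto simp: is_partition_def le_Suc_eq)
  then show thesis using that z s0 by blast
qed

text \<open>Bottom of the reconstruction: everything vanishes, so \<open>m\<close> is one row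
  \<open>z\<close> above rows of length 1. Subtracting \<open>b\<close> accounts modulo
  \<open>p\<close> for the \<open>p - b\<close> nodes of the segment above the cut.\<close>

lemma js_chain_of_strip_zeros:
  assumes "2 \<le> p" "p_regular p m" "strip p b m = replicate s 0" "0 < b" "b \<le> p" "m \<noteq> []"
    "extension p e (int s) (int (sum_list m) - int b)"
  shows "b = p \<and> js_chain p e m \<or>
    b < p \<and> [int (hd m) = e + int b + 1] (mod int p) \<and> js_chain p (e + 2) (tl m)"
proof -
  have "is_partition m" using assms(2) by (simp add: p_regular_def)
  then obtain z where z: "m = z # replicate (s - 1) 1" "0 < z" "z \<le> b" "0 < s"
    using strip_zerosE assms by metis
  have reg: "p_regular p (replicate (s - 1) 1)"
    using assms(2) z(1) p_regular_appendD[of p "[z]"] by simp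
  have c: "count_list m 1 \<le> p - 1"
    using assms(2) by (cases "1 \<in> set m") (auto simp: p_regular_def count_list_0_iff)
  then have s: "s \<le> p" "z = 1 \<Longrightarrow> s < p" using assms(1) z by (auto simp: count_list_replicate split: if_splits)
  have k: "int (sum_list m) - int b = int z + int s - 1 - int b"
    using z by (simp add: sum_list_replicate of_nat_diff)
  have s1: "int (s - 1) = int s - 1" using z by simp
  \<comment> \<open>The tail is empty or a single block of ones with entry \<open>e + 2\<close>; for
    \<open>b = p\<close> the row \<open>z\<close> is a block of its own on top of it.\<close>
  have generic: ?thesis if 1: "[int z = e + int b + 1] (mod int p)" and
    2: "s = 1 \<or> [int s = - e] (mod int p)"
  proof -
    have tl: "js_chain p (e + 2) (tl m)"
      using 2
    proof
      assume "[int s = - e] (mod int p)"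
      then have "[int 1 - int (s - 1) = e + 2] (mod int p)"
        unfolding s1 of_nat_1 cong_iff_dvd_diff by algebra
      then have "js_chain p (e + 2) (replicate (s - 1) 1 @ [])"
        using reg assms(1) by (intro js_chain_replicate_regular) (auto simp: js_chain.Nil)
      then show ?thesis using z by simp
    qed (use z in \<open>simp add: js_chain.Nil\<close>)
    show ?thesis
    proof (cases "b = p")
      case True
      have "js_chain p e (replicate 1 z @ tl m)"
      proof (rule js_chain_replicate_regular)
        show "p_regular p (replicate 1 z @ tl m)" using assms(2) z by simp
        show "[int z - int 1 = e] (mod int p)"
          using 1 unfolding True of_nat_1 cong_iff_dvd_diff by algebra
        have "[e + 2 = int z + int 1] (mod int p)"
          using 1 unfolding True of_nat_1 cong_iff_dvd_diff by algebra
        then show "js_chain p (int z + int 1) (tl m)" using js_chain_cong tl by blast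
      qed (use assms in auto)
      then show ?thesis using True z by simp
    next
      case False
      then show ?thesis using 1 tl z assms by auto
    qed
  qed
  from assms(7)[unfolded k extension_def] show ?thesis
  proof (elim disjE conjE)
    assume h: "[int z + int s - 1 - int b = 0] (mod int p)" "[int s = 0] (mod int p)"
    \<comment> \<open>Contradiction: \<open>s = p\<close> together with regularity forces
      \<open>z > 1\<close>, whereas the size congruence forces \<open>z\<close> to be at most
      1.\<close>
    have "int p \<le> int s" using h(2) z(4) by (intro zdvd_imp_le) (auto simp: cong_0_iff)
    then have sp: "s = p" using s by simp
    then have "1 < z" using s z by (cases "z = 1") auto
    have "[int b + 1 - int z = 0] (mod int p)"
      using h(1) unfolding sp cong_iff_dvd_diff by algebra
    then have "int p \<le> int b + 1 - int z" using z(3) by (intro zdvd_imp_le) (auto simp: cong_0_iff)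
    then show ?thesis using \<open>1 < z\<close> assms(5) by linarith
  next
    assume h: "[int z + int s - 1 - int b = 0] (mod int p)" "[int s = - e] (mod int p)"
    then have "[int z = e + int b + 1] (mod int p)" unfolding cong_iff_dvd_diff by algebra
    then show ?thesis using h generic by blast
  next
    assume h: "[int s = 1] (mod int p)" "[int z + int s - 1 - int b = e + 1] (mod int p)"
    then have "s = 1" using cong_bounded_eq[OF h(1)] z s assms(1) by simp
    moreover have "[int z = e + int b + 1] (mod int p)"
      using h unfolding cong_iff_dvd_diff by algebra
    ultimately show ?thesis using generic by blast
  next
    assume h: "[int z + int s - 1 - int b = int s] (mod int p)" "[int s = 1 - e] (mod int p)"
    have "[int b + 1 - int z = 0] (mod int p)"
      using h(1) unfolding cong_iff_dvd_diff by algebra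
    \<comment> \<open>Only \<open>b = p\<close> and \<open>z = 1\<close> remain, so \<open>m\<close>
      is a single block of ones.\<close>
    then have "int p \<le> int b + 1 - int z" using z(3) by (intro zdvd_imp_le) (auto simp: cong_0_iff)
    then have bz: "b = p" "z = 1" using z assms by linarith+
    then have m: "m = replicate s 1 @ []" using z by (cases s) auto
    have "[int 1 - int s = e] (mod int p)"
      using h(2) unfolding of_nat_1 cong_iff_dvd_diff by algebra
    then have "js_chain p e m"
      using assms m by (simp only: m) (intro js_chain_replicate_regular, auto simp: js_chain.Nil)
    then show ?thesis using bz by simp
  qed
qed

text \<open>The second alternative describes the lower part of a pair of blocks, cut off above the row in
  which the segment passes from the upper to the lower block.\<close>

lemma js_chain_of_strip:
  assumes "js_chain p e l" "2 \<le> p" "p_regular p m" "strip p b m = l @ replicate s 0"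
    "0 < b" "b \<le> p" "m \<noteq> [] \<or> b = p"
    "extension p (e + 2 * int (length l)) (int s) (int (sum_list m) - int (sum_list l) - int b)"
  shows "b = p \<and> js_chain p e m \<or>
    b < p \<and> [int (hd m) = e + int b + 1] (mod int p) \<and> js_chain p (e + 2) (tl m)"
  using assms(1,3-)
proof (induction arbitrary: m b rule: js_chain.induct)
  case (Nil e)
  show ?case
  proof (cases "m = []")
    case True
    then show ?thesis using Nil by (simp add: js_chain.Nil)
  next
    case False
    then show ?thesis using Nil assms(2) by (intro js_chain_of_strip_zeros[of p m b s]) auto
  qed
next
  case (block A x e r)
  obtain a where A: "A = Suc a" using block gr0_conv_Suc by blast
  have P: "is_partition m" using block by (simp add: p_regular_def)
  obtain z m' b' where z: "m = z # replicate a (Suc x) @ m'" "x < z" "strip p b' m' = r @ replicate s 0"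
    "0 < b'" "b' \<le> p"
    "b' = p \<and> z + a = x + b \<or>
     b' < p \<and> (if m' = [] then x = 0 else hd m' = Suc x) \<and>
       (z + a + b' = x + b \<or> (\<exists>i. 1 \<le> i \<and> i \<le> a \<and> b' + Suc a = p + i \<and> z + i = Suc (x + b)))"
    using strip_replicateE[OF P, of b p a x "r @ replicate s 0"] block by (auto simp: A)
  have reg: "p_regular p m'"
    using block.prems(1) p_regular_appendD[of p "z # replicate a (Suc x)"] by (simp add: z(1))
  have e: "[int x - int a - 1 = e] (mod int p)" using block(4) by (simp add: A algebra_simps)
  have ne: "m' \<noteq> [] \<or> b' = p" using z(6) \<open>0 < x\<close> by (auto split: if_splits)
  have ext: "extension p (int x + int A + 2 * int (length r)) (int s)
      (int (sum_list m') - int (sum_list r) - int b')"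
    using block.prems(6)
  proof (rule extension_cong)
    show "[e + 2 * int (length (replicate A x @ r)) = int x + int A + 2 * int (length r)] (mod int p)"
      using e unfolding A length_append length_replicate of_nat_add of_nat_Suc cong_iff_dvd_diff
      by algebra
    have sm: "int (sum_list m) - int (sum_list (replicate A x @ r)) - int b
        = int (sum_list m') - int (sum_list r) + (int z + int a - int x - int b)"
      by (simp add: z(1) A sum_list_replicate algebra_simps)
    \<comment> \<open>The recovered rows lose \<open>z + a - x\<close> nodes. Together with the
      leftover \<open>b'\<close> this equals \<open>b\<close> up to a multiple of \<open>p\<close>,
      whether or not a segment ends among them.\<close>
    have "[int z + int a - int x - int b = - int b'] (mod int p)"
      using z(6)
    proof (elim disjE conjE exE)
      assume h: "b' = p" "z + a = x + b"
      then have "int z + int a = int x + int b" by linarith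
      then show ?thesis by (simp add: h cong_iff_dvd_diff)
    next
      assume "z + a + b' = x + b"
      then have "int z + int a + int b' = int x + int b" by linarith
      then show ?thesis by (simp add: cong_iff_dvd_diff algebra_simps)
    next
      fix i assume "b' + Suc a = p + i" "z + i = Suc (x + b)"
      then have "int z + int a - int x - int b - (- int b') = int p" by linarith
      then show ?thesis by (simp add: cong_iff_dvd_diff)
    qed
    then show "[int (sum_list m) - int (sum_list (replicate A x @ r)) - int b
        = int (sum_list m') - int (sum_list r) - int b'] (mod int p)"
      unfolding sm cong_iff_dvd_diff by algebra
  qed
  from block.IH[OF reg z(3,4,5) ne ext] show ?case
  proof (elim disjE conjE)
    assume h: "b' = p" "js_chain p (int x + int A) m'"
    then have "z + a = x + b" using z(6) by auto
    then have zb: "int z = int x + int b - int a" by linarith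
    \<comment> \<open>A block of \<open>a\<close> rows with part \<open>Suc x\<close> has entry
      \<open>e + 2\<close> and exit \<open>x + A\<close>, as the chain for \<open>m'\<close>
      requires.\<close>
    have tl: "js_chain p (e + 2) (replicate a (Suc x) @ m')"
    proof (rule js_chain_replicate_regular)
      show "p_regular p (replicate a (Suc x) @ m')"
        using block.prems(1) p_regular_appendD[of p "[z]"] by (simp add: z(1))
      show "[int (Suc x) - int a = e + 2] (mod int p)"
        using e unfolding of_nat_Suc cong_iff_dvd_diff by algebra
      show "js_chain p (int (Suc x) + int a) m'" using h(2) by (simp add: A algebra_simps)
    qed (rule assms(2))
    have hd: "[int z = e + int b + 1] (mod int p)"
      using e unfolding zb cong_iff_dvd_diff by algebra
    show ?thesis
    proof (cases "b = p")
      case True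
      have "js_chain p e (replicate 1 z @ (replicate a (Suc x) @ m'))"
      proof (rule js_chain_replicate_regular)
        show "p_regular p (replicate 1 z @ (replicate a (Suc x) @ m'))"
          using block.prems(1) by (simp add: z(1))
        show "[int z - int 1 = e] (mod int p)"
          using hd unfolding True of_nat_1 cong_iff_dvd_diff by algebra
        have "[e + 2 = int z + int 1] (mod int p)"
          using hd unfolding True of_nat_1 cong_iff_dvd_diff by algebra
        then show "js_chain p (int z + int 1) (replicate a (Suc x) @ m')"
          using js_chain_cong tl by blast
      qed (rule assms(2))
      then show ?thesis using True by (simp add: z(1))
    next
      case False
      then show ?thesis using block.prems(4) hd tl by (simp add: z(1))
    qed
  next
    \<comment> \<open>Here the recovered rows form the upper block of a pair. Comparing
      \<open>hd m' = Suc x\<close> with the congruence gives \<open>A + b' = p\<close>, whence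
      \<open>b = p\<close> and \<open>z = Suc x\<close>: a block of \<open>Suc A\<close> equal rows
      including \<open>hd m'\<close>.\<close>
    assume h: "b' < p" "[int (hd m') = int x + int A + int b' + 1] (mod int p)"
      "js_chain p (int x + int A + 2) (tl m')"
    then have m': "m' \<noteq> []" "hd m' = Suc x" using ne z(6) by (auto split: if_splits)
    have "int p dvd int A + int b'"
      using h(2) unfolding m'(2) of_nat_Suc cong_iff_dvd_diff by algebra
    then have "[int A + int b' = int p] (mod int p)" unfolding cong_iff_dvd_diff by algebra
    then have "int A + int b' = int p"
      using h(1) z(4) block(1,2) by (intro cong_bounded_eq) auto
    then have Ab: "A + b' = p" by linarith
    then have "z + a + b' = x + b" using z(6) h(1) by (auto simp: A)
    then have bz: "b = p" "z = Suc x" using Ab z(2) block.prems(4) by (auto simp: A)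
    have m: "m = replicate (Suc A) (Suc x) @ tl m'"
      using m' by (cases m') (simp_all add: z(1) bz A replicate_append_same[symmetric])
    have "js_chain p e m"
      unfolding m
    proof (rule js_chain_replicate_regular)
      show "p_regular p (replicate (Suc A) (Suc x) @ tl m')" using block.prems(1) m by simp
      show "[int (Suc x) - int (Suc A) = e] (mod int p)" using e by (simp add: A algebra_simps)
      show "js_chain p (int (Suc x) + int (Suc A)) (tl m')" using h(3) by (simp add: algebra_simps)
    qed (rule assms(2))
    then show ?thesis using bz by simp
  qed
qed

section \<open>Removal and restoration combined\<close>

lemma sorted_strip:
  assumes "is_partition m" "0 < b" "0 < p"
  shows "sorted_wrt (\<ge>) (strip p b m)"
  using assms
proof (induction p b m rule: strip.induct)
  case (2 p b x xs)
  define n where "n = Suc x - (if xs = [] then 1 else hd xs)"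
  define b' where "b' = (if b \<le> n then p else b - n)"
  have P: "is_partition xs" "\<forall>y\<in>set xs. y \<le> x" using 2 by (auto simp: is_partition_Cons)
  have b': "0 < b'" using 2 by (auto simp: b'_def)
  have s: "strip p b (x # xs) = (x - min b n) # strip p b' xs"
    by (simp add: n_def b'_def Let_def)
  have "sorted_wrt (\<ge>) (strip p b' xs)"
    using 2 P by (auto simp: b'_def n_def)
  moreover have "y \<le> x - min b n" if y: "y \<in> set (strip p b' xs)" for y
  proof -
    have ne: "xs \<noteq> []" using y by auto
    then have "\<forall>y\<in>set xs. y \<le> hd xs" using P(1) by (cases xs) (auto simp: is_partition_Cons)
    then have "y < hd xs" using strip_bounded[OF P(1) b'] y 2 by blast
    moreover have "hd xs \<le> x" using ne P(2) by simp
    ultimately show ?thesis using ne by (simp add: n_def)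
  qed
  ultimately show ?case unfolding s by simp
qed simp

lemma sorted_filter_zeros:
  assumes "sorted_wrt (\<ge>) (l :: nat list)"
  shows "l = filter (\<lambda>n. 0 < n) l @ replicate (length l - length (filter (\<lambda>n. 0 < n) l)) 0"
  using assms
proof (induction l)
  case (Cons x l)
  show ?case
  proof (cases "x = 0")
    case True
    then have "\<forall>y\<in>set l. y = 0" using Cons.prems by simp
    then have "filter (\<lambda>n. 0 < n) l = []" "l = replicate (length l) 0"
      by (auto simp: filter_empty_conv intro: replicate_eqI)
    then show ?thesis using True by simp
  next
    case False
    then show ?thesis using Cons by (simp add: Suc_diff_le)
  qed
qed simp

lemma js_chain_iff_remove_p_rim:
  assumes "2 \<le> p" "p_regular p m"
  defines "l \<equiv> remove_p_rim p m"
  shows "js_chain p e m \<longleftrightarrow> js_chain p e l \<and>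
    extension p (e + 2 * int (length l)) (int (length m) - int (length l)) (int (card (p_rim p m)))"
proof -
  have P: "is_partition m" "0 < p" using assms by (auto simp: p_regular_def)
  have l: "l = filter (\<lambda>n. 0 < n) (strip p p m)" unfolding l_def by (rule remove_p_rim_eq_strip[OF P])
  have card: "int (card (p_rim p m)) = int (sum_list m) - int (sum_list l)"
    unfolding l sum_list_filter_pos by (rule card_p_rim_eq_strip[OF P])
  have st: "strip p p m = l @ replicate (length m - length l) 0"
    using sorted_filter_zeros[OF sorted_strip[OF P(1,2,2)]] unfolding l by simp
  have len: "length l \<le> length m" unfolding l by (metis length_filter_le length_strip)
  show ?thesis
  proof
    assume "js_chain p e m"
    from js_chain_strip[OF assms(1) this] obtain l' s where l':
      "strip p p m = l' @ replicate s 0" "js_chain p e l'"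
      "extension p (e + 2 * int (length l')) (int s) (int (sum_list m) - int (sum_list l'))" by blast
    have "\<forall>x\<in>set l'. 0 < x" using js_chain_regular[OF l'(2)] by (simp add: p_regular_def is_partition_def)
    then have "l = l'" unfolding l l'(1) by (simp add: filter_id_conv)
    moreover have "length m = length l' + s" using arg_cong[OF l'(1), of length] by simp
    ultimately show "js_chain p e l \<and> extension p (e + 2 * int (length l))
        (int (length m) - int (length l)) (int (card (p_rim p m)))"
      using l' card by simp
  next
    assume h: "js_chain p e l \<and> extension p (e + 2 * int (length l))
        (int (length m) - int (length l)) (int (card (p_rim p m)))"
    \<comment> \<open>At the top a full segment is still available, so the subtracted budget is
      \<open>p\<close> and vanishes modulo \<open>p\<close>.\<close>
    then have "extension p (e + 2 * int (length l)) (int (length m) - int (length l))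
        (int (sum_list m) - int (sum_list l) - int p)"
      by (auto elim!: extension_cong simp: card cong_iff_dvd_diff)
    then show "js_chain p e m"
      using js_chain_of_strip[of p e l m p "length m - length l"] h st P assms(1,2) len
      by (simp add: of_nat_diff)
  qed
qed

section \<open>Residue symbols and end values\<close>

lemma residue_symbol_Nil_iff: "0 < p \<Longrightarrow> residue_symbol p l = [] \<longleftrightarrow> l = []"
  by (cases "l = []")
    (simp_all add: residue_symbol_def mullineux_symbol.simps[of p l] mullineux_symbol.simps[of p "[]"])

lemma residue_symbol_snoc:
  assumes "0 < p" "m \<noteq> []"
  shows "residue_symbol p m = residue_symbol p (remove_p_rim p m) @
    [((int (card (p_rim p m)) - int (length m)) mod int p, (1 - int (length m)) mod int p)]"
  using assms by (simp add: residue_symbol_def mullineux_symbol.simps[of p m])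

lemma residue_symbol_snocD:
  assumes "0 < p" "residue_symbol p m = cs @ [(x, y)]"
  shows "residue_symbol p (remove_p_rim p m) = cs" "m \<noteq> []"
    "[x = int (card (p_rim p m)) - int (length m)] (mod int p)" "[y = 1 - int (length m)] (mod int p)"
proof -
  show "m \<noteq> []" using assms residue_symbol_Nil_iff[of p m] by auto
  from residue_symbol_snoc[OF assms(1) this] assms(2)
  show "residue_symbol p (remove_p_rim p m) = cs"
    "[x = int (card (p_rim p m)) - int (length m)] (mod int p)" "[y = 1 - int (length m)] (mod int p)"
    by (auto simp: cong_def)
qed

text \<open>Here \<open>N\<close> and \<open>r\<close> are the numbers of parts before and after the
  extension. The columns correspond in order to s = 1 with k = w + 1, k = s = 1 - w, s = k = 0, and
  s = -w with k = 0, where w = \<alpha> + 2N.\<close>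

lemma extension_iff_columns:
  fixes N r k \<alpha> x y y' :: int
  assumes "[y' = 1 - N] (mod int p)" "[x = k - r] (mod int p)" "[y = 1 - r] (mod int p)"
  shows "extension p (\<alpha> + 2 * N) (r - N) k \<longleftrightarrow>
    [x = \<alpha> + 1 - y'] (mod int p) \<and> [y = y' - 1] (mod int p) \<or>
    [x = y' - 1] (mod int p) \<and> [y = \<alpha> + 1 - y'] (mod int p) \<or>
    [x = y' - 1] (mod int p) \<and> [y = y'] (mod int p) \<or>
    [x = \<alpha> + 1 - y'] (mod int p) \<and> [y = \<alpha> + 2 - y'] (mod int p)"
proof -
  note d = assms[unfolded cong_iff_dvd_diff]
  have y1: "int p dvd y - (y' - 1) \<longleftrightarrow> int p dvd r - N - 1"
  proof
    show "int p dvd r - N - 1" if "int p dvd y - (y' - 1)" using d that by algebra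
    show "int p dvd y - (y' - 1)" if "int p dvd r - N - 1" using d that by algebra
  qed
  have y2: "int p dvd y - (\<alpha> + 1 - y') \<longleftrightarrow> int p dvd r - N - (1 - (\<alpha> + 2 * N))"
  proof
    show "int p dvd r - N - (1 - (\<alpha> + 2 * N))" if "int p dvd y - (\<alpha> + 1 - y')" using d that by algebra
    show "int p dvd y - (\<alpha> + 1 - y')" if "int p dvd r - N - (1 - (\<alpha> + 2 * N))" using d that by algebra
  qed
  have y3: "int p dvd y - y' \<longleftrightarrow> int p dvd r - N - 0"
  proof
    show "int p dvd r - N - 0" if "int p dvd y - y'" using d that by algebra
    show "int p dvd y - y'" if "int p dvd r - N - 0" using d that by algebra
  qed
  have y4: "int p dvd y - (\<alpha> + 2 - y') \<longleftrightarrow> int p dvd r - N - - (\<alpha> + 2 * N)"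
  proof
    show "int p dvd r - N - - (\<alpha> + 2 * N)" if "int p dvd y - (\<alpha> + 2 - y')" using d that by algebra
    show "int p dvd y - (\<alpha> + 2 - y')" if "int p dvd r - N - - (\<alpha> + 2 * N)" using d that by algebra
  qed
  have x1: "int p dvd x - (\<alpha> + 1 - y') \<longleftrightarrow> int p dvd k - (\<alpha> + 2 * N + 1)" if "int p dvd r - N - 1"
  proof
    show "int p dvd k - (\<alpha> + 2 * N + 1)" if "int p dvd x - (\<alpha> + 1 - y')"
      using d that \<open>int p dvd r - N - 1\<close> by algebra
    show "int p dvd x - (\<alpha> + 1 - y')" if "int p dvd k - (\<alpha> + 2 * N + 1)"
      using d that \<open>int p dvd r - N - 1\<close> by algebra
  qed
  have x2: "int p dvd x - (y' - 1) \<longleftrightarrow> int p dvd k - (r - N)"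
  proof
    show "int p dvd k - (r - N)" if "int p dvd x - (y' - 1)" using d that by algebra
    show "int p dvd x - (y' - 1)" if "int p dvd k - (r - N)" using d that by algebra
  qed
  have x3: "int p dvd k - (r - N) \<longleftrightarrow> int p dvd k - 0" if "int p dvd r - N - 0"
    using that by (simp add: dvd_diff_left_iff)
  have x4: "int p dvd x - (\<alpha> + 1 - y') \<longleftrightarrow> int p dvd k - 0" if "int p dvd r - N - - (\<alpha> + 2 * N)"
  proof
    show "int p dvd k - 0" if "int p dvd x - (\<alpha> + 1 - y')"
      using d that \<open>int p dvd r - N - - (\<alpha> + 2 * N)\<close> by algebra
    show "int p dvd x - (\<alpha> + 1 - y')" if "int p dvd k - 0"
      using d that \<open>int p dvd r - N - - (\<alpha> + 2 * N)\<close> by algebra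
  qed
  show ?thesis
    unfolding extension_def cong_iff_dvd_diff using y1 y2 y3 y4 x1 x2 x3 x4 by blast
qed

text \<open>Since \<open>y'\<close> is tied only to the length of the smaller partition, this covers
  both a previous column with \<open>y' = yk\<close> and an empty smaller partition with
  \<open>y' = 1\<close>.\<close>

lemma js_chain_iff_columns:
  assumes "2 \<le> p" "p_regular p m" "residue_symbol p m = cs @ [(x, y)]"
    "[y' = 1 - int (length (remove_p_rim p m))] (mod int p)"
  shows "js_chain p \<alpha> m \<longleftrightarrow> js_chain p \<alpha> (remove_p_rim p m) \<and>
    ([x = \<alpha> + 1 - y'] (mod int p) \<and> [y = y' - 1] (mod int p) \<or>
     [x = y' - 1] (mod int p) \<and> [y = \<alpha> + 1 - y'] (mod int p) \<or>
     [x = y' - 1] (mod int p) \<and> [y = y'] (mod int p) \<or>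
     [x = \<alpha> + 1 - y'] (mod int p) \<and> [y = \<alpha> + 2 - y'] (mod int p))"
proof -
  have "0 < p" using assms(1) by simp
  note D = residue_symbol_snocD[OF this assms(3)]
  show ?thesis
    unfolding js_chain_iff_remove_p_rim[OF assms(1,2)] extension_iff_columns[OF assms(4) D(3,4)] ..
qed

section \<open>End value vectors and the exceptional column\<close>

lemma unit_vec_cong: "[i = j] (mod int p) \<Longrightarrow> unit_vec p i \<gamma> = unit_vec p j \<gamma>"
  by (auto simp: unit_vec_def cong_def)

lemma end_value_snoc:
  assumes "residue_symbol p m = residue_symbol p l @ [(x, y)]"
  shows "end_value p m \<gamma> = end_value p l \<gamma> +
    (unit_vec p x \<gamma> - unit_vec p (x + 1) \<gamma> + unit_vec p y \<gamma> - unit_vec p (y - 1) \<gamma>)"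
proof -
  have "unit_vec p i \<gamma> = (if [i = \<gamma>] (mod int p) then 1 else 0)" for i
    by (simp add: unit_vec_def cong_sym_eq)
  then show ?thesis by (simp add: end_value_def mullineux_sequence_def assms)
qed

text \<open>In a regular extension \<open>x\<close> and \<open>y\<close> cancel the two old negative
  unit vectors, while \<open>x + 1\<close> and \<open>y - 1\<close> supply the new ones. A singular
  column contributes 0 and at most swaps the two positions.\<close>

lemma end_value_js_chain:
  assumes "2 \<le> p" "js_chain p \<alpha> l"
  shows "end_value p l \<gamma> =
    unit_vec p \<alpha> \<gamma> - unit_vec p (- int (length l)) \<gamma> - unit_vec p (\<alpha> + int (length l)) \<gamma>"
  using assms(2)
proof (induction "sum_list l + length l" arbitrary: l rule: less_induct)
  case (less m)
  have p: "0 < p" using assms(1) by simp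
  show ?case
  proof (cases "m = []")
    case True
    have "residue_symbol p [] = []" using p residue_symbol_Nil_iff by blast
    then show ?thesis using True
      by (auto simp: end_value_def mullineux_sequence_def unit_vec_def cong_sym_eq)
  next
    case False
    define l where "l = remove_p_rim p m"
    define x y where "x = (int (card (p_rim p m)) - int (length m)) mod int p"
      and "y = (1 - int (length m)) mod int p"
    have rs: "residue_symbol p m = residue_symbol p l @ [(x, y)]"
      unfolding l_def x_def y_def by (rule residue_symbol_snoc[OF p False])
    define N r where "N = int (length l)" and "r = int (length m)"
    have y: "[y = 1 - r] (mod int p)" by (simp add: y_def r_def cong_def)
    have reg: "p_regular p m" using js_chain_regular less.prems by blast
    have js: "js_chain p \<alpha> l" and cols:
      "[x = \<alpha> + 1 - (1 - N)] (mod int p) \<and> [y = (1 - N) - 1] (mod int p) \<or>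
       [x = (1 - N) - 1] (mod int p) \<and> [y = \<alpha> + 1 - (1 - N)] (mod int p) \<or>
       [x = (1 - N) - 1] (mod int p) \<and> [y = 1 - N] (mod int p) \<or>
       [x = \<alpha> + 1 - (1 - N)] (mod int p) \<and> [y = \<alpha> + 2 - (1 - N)] (mod int p)"
      using js_chain_iff_columns[OF assms(1) reg rs cong_refl, of \<alpha>] less.prems
      unfolding l_def N_def by blast+
    have IH: "end_value p l \<gamma> = unit_vec p \<alpha> \<gamma> - unit_vec p (- N) \<gamma> - unit_vec p (\<alpha> + N) \<gamma>"
      unfolding N_def using less.hyps[OF _ js] remove_p_rim_decreases[OF p False] by (simp add: l_def)
    have "unit_vec p x \<gamma> - unit_vec p (x + 1) \<gamma> + unit_vec p y \<gamma> - unit_vec p (y - 1) \<gamma>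
        = unit_vec p (- N) \<gamma> + unit_vec p (\<alpha> + N) \<gamma> - unit_vec p (- r) \<gamma> - unit_vec p (\<alpha> + r) \<gamma>"
      using cols
    proof (elim disjE conjE)
      assume h: "[x = \<alpha> + 1 - (1 - N)] (mod int p)" "[y = (1 - N) - 1] (mod int p)"
      have "[x = \<alpha> + N] (mod int p)" using h y unfolding cong_iff_dvd_diff by algebra
      moreover have "[x + 1 = \<alpha> + r] (mod int p)" using h y unfolding cong_iff_dvd_diff by algebra
      moreover have "[y = - N] (mod int p)" using h y unfolding cong_iff_dvd_diff by algebra
      moreover have "[y - 1 = - r] (mod int p)" using h y unfolding cong_iff_dvd_diff by algebra
      ultimately show ?thesis by (simp add: unit_vec_cong)
    next
      assume h: "[x = (1 - N) - 1] (mod int p)" "[y = \<alpha> + 1 - (1 - N)] (mod int p)"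
      have "[x = - N] (mod int p)" using h y unfolding cong_iff_dvd_diff by algebra
      moreover have "[x + 1 = \<alpha> + r] (mod int p)" using h y unfolding cong_iff_dvd_diff by algebra
      moreover have "[y = \<alpha> + N] (mod int p)" using h y unfolding cong_iff_dvd_diff by algebra
      moreover have "[y - 1 = - r] (mod int p)" using h y unfolding cong_iff_dvd_diff by algebra
      ultimately show ?thesis by (simp add: unit_vec_cong)
    next
      assume h: "[x = (1 - N) - 1] (mod int p)" "[y = 1 - N] (mod int p)"
      have "[x = y - 1] (mod int p)" using h y unfolding cong_iff_dvd_diff by algebra
      moreover have "[x + 1 = y] (mod int p)" using h y unfolding cong_iff_dvd_diff by algebra
      moreover have "[- r = - N] (mod int p)" using h y unfolding cong_iff_dvd_diff by algebra
      moreover have "[\<alpha> + r = \<alpha> + N] (mod int p)" using h y unfolding cong_iff_dvd_diff by algebra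
      ultimately show ?thesis by (simp add: unit_vec_cong)
    next
      assume h: "[x = \<alpha> + 1 - (1 - N)] (mod int p)" "[y = \<alpha> + 2 - (1 - N)] (mod int p)"
      have "[x = y - 1] (mod int p)" using h y unfolding cong_iff_dvd_diff by algebra
      moreover have "[x + 1 = y] (mod int p)" using h y unfolding cong_iff_dvd_diff by algebra
      moreover have "[- r = \<alpha> + N] (mod int p)" using h y unfolding cong_iff_dvd_diff by algebra
      moreover have "[\<alpha> + r = - N] (mod int p)" using h y unfolding cong_iff_dvd_diff by algebra
      ultimately show ?thesis by (simp add: unit_vec_cong)
    qed
    then show ?thesis unfolding end_value_snoc[OF rs] IH r_def by simp
  qed
qed

text \<open>Otherwise \<open>l\<close> would be a JS-partition of every type at once.\<close>

lemma residue_symbol_singleton_neq: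
  assumes "2 \<le> p" "p_regular p l" "residue_symbol p l = [(x, y)]"
  shows "\<not> ([x = 0] (mod int p) \<and> [y = 1] (mod int p))"
proof
  assume h: "[x = 0] (mod int p) \<and> [y = 1] (mod int p)"
  have p: "0 < p" using assms(1) by simp
  have rs: "residue_symbol p l = [] @ [(x, y)]" using assms(3) by simp
  have Nil: "remove_p_rim p l = []" "l \<noteq> []"
    using residue_symbol_snocD(1,2)[OF p rs] residue_symbol_Nil_iff[OF p] by auto
  \<comment> \<open>Above the empty partition the column with entries 0 and 1 is the third one for
    every \<alpha>.\<close>
  have "js_chain p \<alpha> l" for \<alpha>
    using js_chain_iff_columns[OF assms(1,2) rs, of 1 \<alpha>] h Nil by (simp add: js_chain.Nil)
  then have J: "JS_partition_of_type p \<alpha> l" for \<alpha>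
    using JS_partition_iff_js_chain assms(1) Nil by blast
  have "[1 = 0] (mod int p)"
    using J[of 0] J[of 1] unfolding JS_partition_of_type_def
    by (auto simp: case_prod_beta Let_def dest: cong_sym intro: cong_trans)
  then show False using assms(1) cong_bounded_eq[of 1 0 "int p"] by simp
qed

theorem theorem3p1:
  fixes p :: nat and \<alpha> :: int
  assumes "2 \<le> p" and "0 \<le> \<alpha>" and "\<alpha> < int p"
  shows
    "(\<forall>l x1 y1. p_regular p l \<and> residue_symbol p l = [(x1, y1)] \<longrightarrow>
        (JS_partition_of_type p \<alpha> l \<longleftrightarrow>
           [x1 = 0] (mod int p) \<and> [y1 = \<alpha>] (mod int p) \<or>
           [x1 = \<alpha>] (mod int p) \<and> [y1 = 0] (mod int p) \<or>
           [x1 = \<alpha>] (mod int p) \<and> [y1 = \<alpha> + 1] (mod int p)) \<and>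
        ([x1 = 0] (mod int p) \<and> [y1 = \<alpha>] (mod int p) \<longrightarrow> \<alpha> \<noteq> 1) \<and>
        ([x1 = \<alpha>] (mod int p) \<and> [y1 = \<alpha> + 1] (mod int p) \<longrightarrow> \<alpha> \<noteq> 0))
     \<and>
     (\<forall>m l cs xk yk x y.
        p_regular p m \<and> residue_symbol p m = cs @ [(xk, yk), (x, y)] \<and> l = remove_p_rim p m \<longrightarrow>
        (JS_partition_of_type p \<alpha> m \<longleftrightarrow>
           JS_partition_of_type p \<alpha> l \<and>
           ([x = \<alpha> + 1 - yk] (mod int p) \<and> [y = yk - 1] (mod int p) \<and>
              \<not> [2 * yk = \<alpha> + 3] (mod int p) \<or>
            [x = yk - 1] (mod int p) \<and> [y = \<alpha> + 1 - yk] (mod int p) \<and>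
              \<not> [2 * yk = \<alpha> + 1] (mod int p) \<or>
            [x = yk - 1] (mod int p) \<and> [y = yk] (mod int p) \<or>
            [x = \<alpha> + 1 - yk] (mod int p) \<and> [y = \<alpha> + 2 - yk] (mod int p))))
     \<and>
     (\<forall>l cs xk yk.
        JS_partition_of_type p \<alpha> l \<and> residue_symbol p l = cs @ [(xk, yk)] \<longrightarrow>
        (\<forall>\<gamma>\<in>{0..<int p}. end_value p l \<gamma> = - unit_vec p 0 \<gamma>) \<and>
          ([yk = 1] (mod int p) \<or> [yk = \<alpha> + 1] (mod int p))
        \<or>
        (\<exists>\<beta>\<in>{0..<int p}. \<beta> \<noteq> \<alpha> \<and>
          (\<forall>\<gamma>\<in>{0..<int p}. end_value p l \<gamma> =
             unit_vec p \<alpha> \<gamma> - unit_vec p \<beta> \<gamma> - unit_vec p (\<alpha> - \<beta>) \<gamma>) \<and>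
          ([yk = 1 + \<beta>] (mod int p) \<or> [yk = \<alpha> + 1 - \<beta>] (mod int p)))
        \<or>
        (\<alpha> \<noteq> 0 \<and> even \<alpha> \<and>
          (\<forall>\<gamma>\<in>{0..<int p}. end_value p l \<gamma> =
             unit_vec p \<alpha> \<gamma> - 2 * unit_vec p (\<alpha> div 2) \<gamma>) \<and>
          [yk = \<alpha> div 2 + 1] (mod int p)
         \<or>
         even (\<alpha> + int p) \<and>
          (\<forall>\<gamma>\<in>{0..<int p}. end_value p l \<gamma> =
             unit_vec p \<alpha> \<gamma> - 2 * unit_vec p ((\<alpha> + int p) div 2) \<gamma>) \<and>
          [yk = (\<alpha> + int p) div 2 + 1] (mod int p)))"
proof (intro conjI allI impI)
  note p = assms(1)
  have p0: "0 < p" using p by simp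
  {
    fix l x1 y1
    assume h: "p_regular p l \<and> residue_symbol p l = [(x1, y1)]"
    then have reg: "p_regular p l" and rs: "residue_symbol p l = [] @ [(x1, y1)]" by auto
    note excl = residue_symbol_singleton_neq[OF p reg, of x1 y1]
    have Nil: "remove_p_rim p l = []" "l \<noteq> []"
      using residue_symbol_snocD(1,2)[OF p0 rs] residue_symbol_Nil_iff[OF p0] by auto
    \<comment> \<open>Taking \<open>y' = 1\<close> gives four columns. The one with entries 0 and 1
      is impossible by \<open>excl\<close>, which also yields both restrictions on \<alpha>.\<close>
    have "js_chain p \<alpha> l \<longleftrightarrow>
        [x1 = \<alpha> + 1 - 1] (mod int p) \<and> [y1 = 1 - 1] (mod int p) \<or>
        [x1 = 1 - 1] (mod int p) \<and> [y1 = \<alpha> + 1 - 1] (mod int p) \<or>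
        [x1 = 1 - 1] (mod int p) \<and> [y1 = 1] (mod int p) \<or>
        [x1 = \<alpha> + 1 - 1] (mod int p) \<and> [y1 = \<alpha> + 2 - 1] (mod int p)"
      using js_chain_iff_columns[OF p reg rs, of 1 \<alpha>] by (simp add: Nil js_chain.Nil)
    then show "JS_partition_of_type p \<alpha> l \<longleftrightarrow>
           [x1 = 0] (mod int p) \<and> [y1 = \<alpha>] (mod int p) \<or>
           [x1 = \<alpha>] (mod int p) \<and> [y1 = 0] (mod int p) \<or>
           [x1 = \<alpha>] (mod int p) \<and> [y1 = \<alpha> + 1] (mod int p)"
      using excl h Nil(2) unfolding JS_partition_iff_js_chain[OF p] by (auto simp: add.commute)
    show "\<alpha> \<noteq> 1" if "[x1 = 0] (mod int p) \<and> [y1 = \<alpha>] (mod int p)"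
      using that excl h by auto
    show "\<alpha> \<noteq> 0" if "[x1 = \<alpha>] (mod int p) \<and> [y1 = \<alpha> + 1] (mod int p)"
      using that excl h by auto
  next
    fix m l cs xk yk x y
    assume h: "p_regular p m \<and> residue_symbol p m = cs @ [(xk, yk), (x, y)] \<and> l = remove_p_rim p m"
    then have reg: "p_regular p m" and rs: "residue_symbol p m = (cs @ [(xk, yk)]) @ [(x, y)]"
      and l: "l = remove_p_rim p m" by auto
    note D = residue_symbol_snocD[OF p0 rs]
    note D' = residue_symbol_snocD[OF p0 D(1)]
    \<comment> \<open>Where a regular extension is forbidden, its column coincides with a singular
      one having the same \<open>x\<close>, so the side conditions exclude no pair.\<close>
    have "[x = \<alpha> + 1 - yk] (mod int p) \<Longrightarrow> [y = yk - 1] (mod int p) \<Longrightarrow>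
        [2 * yk = \<alpha> + 3] (mod int p) \<Longrightarrow> [y = \<alpha> + 2 - yk] (mod int p)"
      unfolding cong_iff_dvd_diff by algebra
    moreover have "[x = yk - 1] (mod int p) \<Longrightarrow> [y = \<alpha> + 1 - yk] (mod int p) \<Longrightarrow>
        [2 * yk = \<alpha> + 1] (mod int p) \<Longrightarrow> [y = yk] (mod int p)"
      unfolding cong_iff_dvd_diff by algebra
    ultimately show "JS_partition_of_type p \<alpha> m \<longleftrightarrow>
           JS_partition_of_type p \<alpha> l \<and>
           ([x = \<alpha> + 1 - yk] (mod int p) \<and> [y = yk - 1] (mod int p) \<and>
              \<not> [2 * yk = \<alpha> + 3] (mod int p) \<or>
            [x = yk - 1] (mod int p) \<and> [y = \<alpha> + 1 - yk] (mod int p) \<and>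
              \<not> [2 * yk = \<alpha> + 1] (mod int p) \<or>
            [x = yk - 1] (mod int p) \<and> [y = yk] (mod int p) \<or>
            [x = \<alpha> + 1 - yk] (mod int p) \<and> [y = \<alpha> + 2 - yk] (mod int p))"
      using js_chain_iff_columns[OF p reg rs D'(4), of \<alpha>] D(2) D'(2)
      unfolding JS_partition_iff_js_chain[OF p] l by blast
  next
    fix l cs xk yk
    assume h: "JS_partition_of_type p \<alpha> l \<and> residue_symbol p l = cs @ [(xk, yk)]"
    then have js: "js_chain p \<alpha> l" using JS_partition_iff_js_chain[OF p] by blast
    have yk: "[yk = 1 - int (length l)] (mod int p)" using residue_symbol_snocD(4)[OF p0] h by blast
    \<comment> \<open>Chosen so that \<beta> is the residue of minus the number of parts.\<close>
    define \<beta> where "\<beta> = (yk - 1) mod int p"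
    have \<beta>: "\<beta> \<in> {0..<int p}" "[yk = 1 + \<beta>] (mod int p)"
      using p0 by (auto simp: \<beta>_def cong_def mod_simps)
    have "[- int (length l) = \<beta>] (mod int p)" using yk \<beta>(2) unfolding cong_iff_dvd_diff by algebra
    moreover have "[\<alpha> + int (length l) = \<alpha> - \<beta>] (mod int p)"
      using yk \<beta>(2) unfolding cong_iff_dvd_diff by algebra
    ultimately have ev: "end_value p l \<gamma> = unit_vec p \<alpha> \<gamma> - unit_vec p \<beta> \<gamma> - unit_vec p (\<alpha> - \<beta>) \<gamma>" for \<gamma>
      using end_value_js_chain[OF p js, of \<gamma>] by (simp add: unit_vec_cong)
    show "(\<forall>\<gamma>\<in>{0..<int p}. end_value p l \<gamma> = - unit_vec p 0 \<gamma>) \<and>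
          ([yk = 1] (mod int p) \<or> [yk = \<alpha> + 1] (mod int p))
        \<or>
        (\<exists>\<beta>\<in>{0..<int p}. \<beta> \<noteq> \<alpha> \<and>
          (\<forall>\<gamma>\<in>{0..<int p}. end_value p l \<gamma> =
             unit_vec p \<alpha> \<gamma> - unit_vec p \<beta> \<gamma> - unit_vec p (\<alpha> - \<beta>) \<gamma>) \<and>
          ([yk = 1 + \<beta>] (mod int p) \<or> [yk = \<alpha> + 1 - \<beta>] (mod int p)))
        \<or>
        (\<alpha> \<noteq> 0 \<and> even \<alpha> \<and>
          (\<forall>\<gamma>\<in>{0..<int p}. end_value p l \<gamma> =
             unit_vec p \<alpha> \<gamma> - 2 * unit_vec p (\<alpha> div 2) \<gamma>) \<and>
          [yk = \<alpha> div 2 + 1] (mod int p)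
         \<or>
         even (\<alpha> + int p) \<and>
          (\<forall>\<gamma>\<in>{0..<int p}. end_value p l \<gamma> =
             unit_vec p \<alpha> \<gamma> - 2 * unit_vec p ((\<alpha> + int p) div 2) \<gamma>) \<and>
          [yk = (\<alpha> + int p) div 2 + 1] (mod int p))"
    \<comment> \<open>If \<beta> = \<alpha> the first two unit vectors cancel and \<alpha> - \<beta>
      = 0 leaves the first shape; otherwise \<beta> witnesses the second.\<close>
    proof (cases "\<beta> = \<alpha>")
      case True
      then have "[yk = \<alpha> + 1] (mod int p)" using \<beta>(2) by (simp add: add.commute)
      then show ?thesis using ev True by simp
    next
      case False
      then show ?thesis using ev \<beta> by blast
    qed
  }
qed

end
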